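(* Let $K$ be a valued field with valuation ring $R$ and residue field $k$. Suppose that the value group has a minimal strictly positive element and let $\pi\in R$ have this minimal strictly positive valuation. Let $\mathcal{L}$ be an expansion of $\mathcal{L}_{\rm v}$ (interpreted on $K$) and let $\mathrm{ac}:K\to k$ be an angular component map. Put $R^{(1)}=\{x\in R\mid \mathrm{ac}(x)=1\}$. If $R^{(1)}$ is $\mathcal{L}$-definable and $H(K,\mathcal{L})=\mathbb{Z}$, then $$K_0(K,\mathcal{L})=0,\qquad K\cong_{\mathcal{L}}K^\times,\quad\text{and}\quad R\cong_{\mathcal{L}}R\setminus\{0\},$$ where $K^\times=K\setminus\{0\}$.
   Context: Valued field: a field $K$ with a map $v:K\to G\cup\{\infty\}$, $G$ an ordered abelian group (the value group), with $v(x)=\infty$ iff $x=0$, $v(xy)=v(x)+v(y)$, $v(x+y)\ge\min\{v(x),v(y)\}$. The valuation ring is $R=\{x\in K\mid v(x)\ge 0\}$, $M$ is its maximal ideal, $k=R/M$ the residue field. An angular component map is a group homomorphism $\mathrm{ac}:K^\times\to k^\times$, extended by $\mathrm{ac}(0)=0$, with $\mathrm{ac}(x)=x\bmod M$ whenever $v(x)=0$. $\mathcal{L}_{\rm ring}=(+,-,\cdot,0,1)$ is the language of rings; $\mathcal{L}_{\rm v}=(\mathcal{L}_{\rm ring},R)$ is the language of rings with an extra unary relation symbol interpreted as the valuation ring $R$. Definable always means definable with parameters; a function is definable if its graph is. The group $H(K,\mathcal{L})$: for $\mathcal{L}$ an expansion of $\mathcal{L}_{\rm ring}$, let $P_n=P_n(K)$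 be the set of $n$-th powers in $K^\times$. For $n>1$ put $r_n(K)=\#\{x\in K\mid x^n=1\}$ and $s_n(K)=[K^\times:P_n(K)]$ (possibly $\infty$). Put $\lambda_n(K,\mathcal{L})=s_n(K)/r_n(K)$ if both of the following hold: (1) $s_n(K)<\infty$ and $s_n(K)/r_n(K)\in\mathbb{Z}$; (2) there is an $\mathcal{L}$-definable $n$-th root function, i.e. there exist a definable set $\sqrt[n]{P_n}\subset K^\times$ and a definable bijection $\sqrt[n]{\ }:P_n(K)\to\sqrt[n]{P_n}$ with $(\sqrt[n]{x})^n=x$ for each $x\in P_n(K)$. Otherwise put $\lambda_n(K,\mathcal{L})=1$. $H(K,\mathcal{L})$ is the subgroup of $\mathbb{Z}$ generated by the numbers $\lambda_n(K,\mathcal{L})-1$ for all $n>1$. Grothendieck ring: for $\mathcal{L}$-definable sets $X\subset K^m$, $Y\subset K^n$ ($m,n>0$), write $X\cong_{\mathcal{L}}Y$ if there is an $\mathcal{L}$-definable bijection $X\to Y$. $K_0(K,\mathcal{L})$ is the abelian group generated by symbols $[A]$, for $A$ an $\mathcal{L}$-definable set, with the relations $[A]=[A']$ if $A\cong_{\mathcal{L}}A'$, and $[A]=[B]+[C]$ if $A$ is the disjoint union of the definable sets $B$ and $C$; it is a ring with multiplication induced by $[A\times B]=[A][B]$ (the unit is the class of a point). *)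

theory Defs
  imports
    "HOL-Algebra.Algebra"
    "HOL-Algebra.Algebraic_Closure_Type"
    "HOL-Algebra.Multiplicative_Group"
    "HOL-Computational_Algebra.Group_Closure"
    "HOL-Library.Poly_Mapping"
begin

section \<open>Expansions of the language of rings\<close>

datatype 'f trm =
    TVar nat
  | TZero
  | TOne
  | TAdd "'f trm" "'f trm"
  | TSub "'f trm" "'f trm"
  | TMul "'f trm" "'f trm"
  | TFun 'f "'f trm list"

text \<open>Variables are de Bruijn indices: inside \<open>FEx \<phi>\<close>, the index 0 is the bound variable and the
  index \<open>Suc i\<close> is the variable with index \<open>i\<close> outside.\<close>

datatype ('f, 'r) fml =
    FEq "'f trm" "'f trm"
  | FRel 'r "'f trm list"
  | FNot "('f, 'r) fml"
  | FAnd "('f, 'r) fml" "('f, 'r) fml"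
  | FEx "('f, 'r) fml"

text \<open>An expansion of the language of rings, together with its interpretation on a ring whose
  universe is the type \<open>'a\<close>. Only the symbols beyond the ring symbols are recorded; the ring symbols
  are interpreted by the ring operations of \<open>'a\<close>. The symbol sets may be empty, which gives the
  language of rings itself.\<close>

record ('f, 'r, 'a) ring_expansion =
  fun_syms :: "'f set"
  fun_arity :: "'f \<Rightarrow> nat"
  fun_interp :: "'f \<Rightarrow> 'a list \<Rightarrow> 'a"
  rel_syms :: "'r set"
  rel_arity :: "'r \<Rightarrow> nat"
  rel_interp :: "'r \<Rightarrow> 'a list \<Rightarrow> bool"

fun wf_trm :: "('f, 'r, 'a) ring_expansion \<Rightarrow> 'f trm \<Rightarrow> bool" where
  "wf_trm L (TVar i) \<longleftrightarrow> True"
| "wf_trm L TZero \<longleftrightarrow> True"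
| "wf_trm L TOne \<longleftrightarrow> True"
| "wf_trm L (TAdd s t) \<longleftrightarrow> wf_trm L s \<and> wf_trm L t"
| "wf_trm L (TSub s t) \<longleftrightarrow> wf_trm L s \<and> wf_trm L t"
| "wf_trm L (TMul s t) \<longleftrightarrow> wf_trm L s \<and> wf_trm L t"
| "wf_trm L (TFun f ts) \<longleftrightarrow>
     f \<in> fun_syms L \<and> length ts = fun_arity L f \<and> (\<forall>t\<in>set ts. wf_trm L t)"

fun wf_fml :: "('f, 'r, 'a) ring_expansion \<Rightarrow> ('f, 'r) fml \<Rightarrow> bool" where
  "wf_fml L (FEq s t) \<longleftrightarrow> wf_trm L s \<and> wf_trm L t"
| "wf_fml L (FRel r ts) \<longleftrightarrow>
     r \<in> rel_syms L \<and> length ts = rel_arity L r \<and> (\<forall>t\<in>set ts. wf_trm L t)"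
| "wf_fml L (FNot \<phi>) \<longleftrightarrow> wf_fml L \<phi>"
| "wf_fml L (FAnd \<phi> \<psi>) \<longleftrightarrow> wf_fml L \<phi> \<and> wf_fml L \<psi>"
| "wf_fml L (FEx \<phi>) \<longleftrightarrow> wf_fml L \<phi>"

fun eval_trm :: "('f, 'r, 'a::field) ring_expansion \<Rightarrow> (nat \<Rightarrow> 'a) \<Rightarrow> 'f trm \<Rightarrow> 'a" where
  "eval_trm L e (TVar i) = e i"
| "eval_trm L e TZero = 0"
| "eval_trm L e TOne = 1"
| "eval_trm L e (TAdd s t) = eval_trm L e s + eval_trm L e t"
| "eval_trm L e (TSub s t) = eval_trm L e s - eval_trm L e t"
| "eval_trm L e (TMul s t) = eval_trm L e s * eval_trm L e t"
| "eval_trm L e (TFun f ts) = fun_interp L f (map (eval_trm L e) ts)"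

fun sat :: "('f, 'r, 'a::field) ring_expansion \<Rightarrow> (nat \<Rightarrow> 'a) \<Rightarrow> ('f, 'r) fml \<Rightarrow> bool" where
  "sat L e (FEq s t) \<longleftrightarrow> eval_trm L e s = eval_trm L e t"
| "sat L e (FRel r ts) \<longleftrightarrow> rel_interp L r (map (eval_trm L e) ts)"
| "sat L e (FNot \<phi>) \<longleftrightarrow> \<not> sat L e \<phi>"
| "sat L e (FAnd \<phi> \<psi>) \<longleftrightarrow> sat L e \<phi> \<and> sat L e \<psi>"
| "sat L e (FEx \<phi>) \<longleftrightarrow> (\<exists>a. sat L (case_nat a e) \<phi>)"


section \<open>Definable sets and definable bijections\<close>

text \<open>Subsets of \<open>K\<^sup>n\<close> are sets of lists of length \<open>n\<close>. The variables with index at least \<open>n\<close> carry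
  the parameters \<open>p\<close>; a formula mentions only finitely many of them.\<close>

definition definable :: "('f, 'r, 'a::field) ring_expansion \<Rightarrow> nat \<Rightarrow> 'a list set \<Rightarrow> bool" where
  "definable L n D \<longleftrightarrow>
     (\<exists>\<phi> p. wf_fml L \<phi> \<and>
        D = {xs. length xs = n \<and> sat L (\<lambda>i. if i < n then xs ! i else p (i - n)) \<phi>})"

text \<open>Subsets of \<open>K\<close> seen as subsets of \<open>K\<^sup>1\<close>.\<close>

definition pts :: "'a set \<Rightarrow> 'a list set" where
  "pts S = (\<lambda>x. [x]) ` S"

definition definable_sets :: "('f, 'r, 'a::field) ring_expansion \<Rightarrow> 'a list set set" where
  "definable_sets L = {D. \<exists>n>0. definable L n D}"

definition definable_bij ::
  "('f, 'r, 'a::field) ring_expansion \<Rightarrow> 'a list set \<Rightarrow> 'a list set \<Rightarrow> bool" where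
  "definable_bij L D E \<longleftrightarrow>
     (\<exists>m>0. \<exists>n>0. definable L m D \<and> definable L n E \<and>
        (\<exists>f. bij_betw f D E \<and> definable L (m + n) {xs @ f xs | xs. xs \<in> D}))"


section \<open>The Grothendieck ring\<close>

definition set_times :: "'a list set \<Rightarrow> 'a list set \<Rightarrow> 'a list set" where
  "set_times A B = {xs @ ys | xs ys. xs \<in> A \<and> ys \<in> B}"

text \<open>The free abelian group on the definable sets, with the product that extends \<open>A \<times> B\<close>
  bilinearly. Since \<open>K\<^sup>0\<close> is not among the ambient spaces, there is no unit yet: the class of a point
  becomes the unit only modulo the relations below.\<close>

definition groth_free :: "('f, 'r, 'a::field) ring_expansion \<Rightarrow> ('a list set \<Rightarrow>\<^sub>0 int) ring" where
  "groth_free L = \<lparr>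
     carrier = {c. Poly_Mapping.keys c \<subseteq> definable_sets L},
     monoid.mult = (\<lambda>c d. frag_extend (\<lambda>A. frag_extend (\<lambda>B. frag_of (set_times A B)) d) c),
     one = frag_of (pts {0}),
     ring.zero = 0,
     add = (+) \<rparr>"

definition groth_relations :: "('f, 'r, 'a::field) ring_expansion \<Rightarrow> ('a list set \<Rightarrow>\<^sub>0 int) set" where
  "groth_relations L =
     {frag_of A - frag_of A' | A A'.
        A \<in> definable_sets L \<and> A' \<in> definable_sets L \<and> definable_bij L A A'} \<union>
     {frag_of A - (frag_of B + frag_of C) | A B C.
        A \<in> definable_sets L \<and> B \<in> definable_sets L \<and> C \<in> definable_sets L \<and>
        A = B \<union> C \<and> B \<inter> C = {}}"

text \<open>The quotient as an abelian group is by the subgroup generated by the relations. This subgroup is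
  stable under multiplication by \<^const>\<open>groth_free\<close>, because both kinds of relations are compatible
  with products, so the coset multiplication of \<^const>\<open>FactRing\<close> is \<open>[A][B] = [A \<times> B]\<close>.\<close>

definition groth_ring :: "('f, 'r, 'a::field) ring_expansion \<Rightarrow> ('a list set \<Rightarrow>\<^sub>0 int) set ring" where
  "groth_ring L = groth_free L Quot group_closure (groth_relations L)"


section \<open>The group \<open>H(K, L)\<close>\<close>

abbreviation field_ring :: "'a::field ring" where
  "field_ring \<equiv> ring_of_type_algebra"

abbreviation units_grp :: "'a::field monoid" where
  "units_grp \<equiv> Multiplicative_Group.mult_of field_ring"

definition nth_powers :: "nat \<Rightarrow> 'a::field set" where
  "nth_powers n = {x ^ n | x. x \<noteq> 0}"

definition num_roots_of_unity :: "'a::field itself \<Rightarrow> nat \<Rightarrow> nat" where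
  "num_roots_of_unity _ n = card {x::'a. x ^ n = 1}"

definition power_cosets :: "nat \<Rightarrow> 'a::field set set" where
  "power_cosets n = rcosets\<^bsub>units_grp\<^esub> (nth_powers n)"

definition has_definable_root :: "('f, 'r, 'a::field) ring_expansion \<Rightarrow> nat \<Rightarrow> bool" where
  "has_definable_root L n \<longleftrightarrow>
     (\<exists>S f. S \<subseteq> UNIV - {0} \<and> definable L 1 (pts S) \<and>
        bij_betw f (nth_powers n) S \<and>
        definable L 2 {[x, f x] | x. x \<in> nth_powers n} \<and>
        (\<forall>x\<in>nth_powers n. f x ^ n = x))"

text \<open>The cardinality of \<^const>\<open>power_cosets\<close> is the index of the subgroup of \<open>n\<close>-th powers as soon
  as this index is finite.\<close>

definition lambda_num :: "('f, 'r, 'a::field) ring_expansion \<Rightarrow> nat \<Rightarrow> int" where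
  "lambda_num L n =
     (let s = card (power_cosets n :: 'a set set); r = num_roots_of_unity TYPE('a) n in
      if finite (power_cosets n :: 'a set set) \<and> r dvd s \<and> has_definable_root L n
      then int (s div r) else 1)"

definition H_group :: "('f, 'r, 'a::field) ring_expansion \<Rightarrow> int set" where
  "H_group L = group_closure {lambda_num L n - 1 | n. n > 1}"


section \<open>Valued fields and angular components\<close>

datatype 'g with_infty = Fin 'g | Infty

instantiation with_infty :: (linorder) linorder
begin

fun less_eq_with_infty :: "'a with_infty \<Rightarrow> 'a with_infty \<Rightarrow> bool" where
  "x \<le> Infty \<longleftrightarrow> True"
| "Infty \<le> Fin b \<longleftrightarrow> False"
| "Fin a \<le> Fin b \<longleftrightarrow> a \<le> b"

definition less_with_infty :: "'a with_infty \<Rightarrow> 'a with_infty \<Rightarrow> bool" where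
  "x < y \<longleftrightarrow> x \<le> y \<and> \<not> y \<le> (x :: 'a with_infty)"

instance
proof
  fix x y z :: "'a with_infty"
  show "x < y \<longleftrightarrow> x \<le> y \<and> \<not> y \<le> x" by (fact less_with_infty_def)
  show "x \<le> x" by (cases x) auto
  show "x \<le> z" if "x \<le> y" "y \<le> z" using that by (cases x; cases y; cases z) auto
  show "x = y" if "x \<le> y" "y \<le> x" using that by (cases x; cases y) auto
  show "x \<le> y \<or> y \<le> x" by (cases x; cases y) auto
qed

end

lemma less_with_infty_simps [simp]:
  "\<not> Infty < (x :: 'a::linorder with_infty)"
  "Fin a < Infty"
  "Fin a < Fin b \<longleftrightarrow> a < (b :: 'a)"
  by (auto simp: less_with_infty_def)

instantiation with_infty :: (comm_monoid_add) comm_monoid_add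
begin

fun plus_with_infty :: "'a with_infty \<Rightarrow> 'a with_infty \<Rightarrow> 'a with_infty" where
  "Fin a + Fin b = Fin (a + b)"
| "Infty + y = Infty"
| "x + Infty = Infty"

definition zero_with_infty :: "'a with_infty" where
  "0 = Fin (0 :: 'a)"

instance
proof
  fix x y z :: "'a with_infty"
  show "x + y + z = x + (y + z)" by (cases x; cases y; cases z) (auto simp: add.assoc)
  show "x + y = y + x" by (cases x; cases y) (auto simp: add.commute)
  show "0 + x = x" by (cases x) (auto simp: zero_with_infty_def)
qed

end

locale valued_field =
  fixes v :: "'a::field \<Rightarrow> 'g::linordered_ab_group_add with_infty"
  assumes val_infty_iff: "v x = Infty \<longleftrightarrow> x = 0"
    and val_mult: "v (x * y) = v x + v y"
    and val_add: "min (v x) (v y) \<le> v (x + y)"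

definition value_group :: "('a::field \<Rightarrow> 'g::linordered_ab_group_add with_infty) \<Rightarrow> 'g set" where
  "value_group v = {g. \<exists>x. v x = Fin g}"

definition val_ring :: "('a::field \<Rightarrow> 'g::linordered_ab_group_add with_infty) \<Rightarrow> 'a set" where
  "val_ring v = {x. v x \<ge> 0}"

definition max_ideal :: "('a::field \<Rightarrow> 'g::linordered_ab_group_add with_infty) \<Rightarrow> 'a set" where
  "max_ideal v = {x. v x > 0}"

abbreviation val_subring :: "('a::field \<Rightarrow> 'g::linordered_ab_group_add with_infty) \<Rightarrow> 'a ring" where
  "val_subring v \<equiv> field_ring\<lparr>carrier := val_ring v\<rparr>"

definition residue_field :: "('a::field \<Rightarrow> 'g::linordered_ab_group_add with_infty) \<Rightarrow> 'a set ring" where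
  "residue_field v = val_subring v Quot max_ideal v"

definition angular_component ::
  "('a::field \<Rightarrow> 'g::linordered_ab_group_add with_infty) \<Rightarrow> ('a \<Rightarrow> 'a set) \<Rightarrow> bool" where
  "angular_component v ac \<longleftrightarrow>
     ac \<in> hom units_grp (Multiplicative_Group.mult_of (residue_field v)) \<and>
     ac 0 = \<zero>\<^bsub>residue_field v\<^esub> \<and>
     (\<forall>x. v x = 0 \<longrightarrow> ac x = max_ideal v +>\<^bsub>val_subring v\<^esub> x)"

definition expands_valued_field ::
  "('f, 'r, 'a::field) ring_expansion \<Rightarrow> ('a \<Rightarrow> 'g::linordered_ab_group_add with_infty) \<Rightarrow> bool" where
  "expands_valued_field L v \<longleftrightarrow>
     (\<exists>r\<in>rel_syms L. rel_arity L r = 1 \<and> (\<forall>x. rel_interp L r [x] \<longleftrightarrow> x \<in> val_ring v))"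


context valued_field
begin

lemma val_zero [simp]: "v 0 = Infty"
  by (simp add: val_infty_iff)

lemma val_fin: "x \<noteq> 0 \<Longrightarrow> \<exists>g. v x = Fin g"
  using val_infty_iff by (cases "v x") auto

lemma val_one [simp]: "v 1 = 0"
proof -
  obtain g where g: "v 1 = Fin g" using val_fin[of 1] by auto
  have "v 1 = v 1 + v 1" using val_mult[of 1 1] by simp
  then show ?thesis using g by (simp add: zero_with_infty_def)
qed

lemma val_minus [simp]: "v (- x) = v x"
proof -
  obtain g where g: "v (- 1) = Fin g" using val_fin[of "- 1"] by auto
  have "v (- 1) + v (- 1) = 0" using val_mult[of "- 1" "- 1"] by simp
  then have "g = 0" using g by (simp add: zero_with_infty_def)
  then have "v (- 1) = 0" using g by (simp add: zero_with_infty_def)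
  then show ?thesis using val_mult[of "- 1" x] by simp
qed

lemma val_inverse:
  assumes "v x = Fin g"
  shows "v (inverse x) = Fin (- g)"
proof -
  have x: "x \<noteq> 0" using assms val_infty_iff by force
  then obtain h where h: "v (inverse x) = Fin h" using val_fin[of "inverse x"] by auto
  have "v x + v (inverse x) = 0" using val_mult[of x "inverse x"] x by simp
  then show ?thesis
    using assms h by (simp add: zero_with_infty_def eq_neg_iff_add_eq_0 add.commute)
qed

lemma val_ring_closed:
  "0 \<in> val_ring v" "1 \<in> val_ring v"
  "x \<in> val_ring v \<Longrightarrow> - x \<in> val_ring v"
  "x \<in> val_ring v \<Longrightarrow> y \<in> val_ring v \<Longrightarrow> x + y \<in> val_ring v"
  "x \<in> val_ring v \<Longrightarrow> y \<in> val_ring v \<Longrightarrow> x * y \<in> val_ring v"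
proof -
  show "0 \<in> val_ring v" "1 \<in> val_ring v" "x \<in> val_ring v \<Longrightarrow> - x \<in> val_ring v"
    by (auto simp: val_ring_def)
  show "x + y \<in> val_ring v" if "x \<in> val_ring v" "y \<in> val_ring v"
    using that val_add[of x y] by (auto simp: val_ring_def min_def split: if_splits)
  show "x * y \<in> val_ring v" if "x \<in> val_ring v" "y \<in> val_ring v"
    using that unfolding val_ring_def
    by (cases "v x"; cases "v y") (auto simp: val_mult zero_with_infty_def)
qed

lemma max_ideal_closed:
  "0 \<in> max_ideal v"
  "x \<in> max_ideal v \<Longrightarrow> - x \<in> max_ideal v"
  "x \<in> max_ideal v \<Longrightarrow> y \<in> max_ideal v \<Longrightarrow> x + y \<in> max_ideal v"
  "x \<in> max_ideal v \<Longrightarrow> y \<in> val_ring v \<Longrightarrow> x * y \<in> max_ideal v"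
proof -
  show "0 \<in> max_ideal v" "x \<in> max_ideal v \<Longrightarrow> - x \<in> max_ideal v"
    by (auto simp: max_ideal_def zero_with_infty_def)
  show "x + y \<in> max_ideal v" if "x \<in> max_ideal v" "y \<in> max_ideal v"
    using that val_add[of x y] by (auto simp: max_ideal_def min_def split: if_splits)
  show "x * y \<in> max_ideal v" if "x \<in> max_ideal v" "y \<in> val_ring v"
    using that unfolding val_ring_def max_ideal_def
    by (cases "v x"; cases "v y") (auto simp: val_mult zero_with_infty_def add_pos_nonneg)
qed

lemma cring_val_subring: "cring (val_subring v)"
proof (rule cringI)
  show "abelian_group (val_subring v)"
  proof (rule abelian_groupI)
    fix x assume "x \<in> carrier (val_subring v)"
    then show "\<exists>y\<in>carrier (val_subring v). y \<oplus>\<^bsub>val_subring v\<^esub> x = \<zero>\<^bsub>val_subring v\<^esub>"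
      using val_ring_closed(3)[of x]
      by (intro bexI[of _ "- x"]) (auto simp: ring_of_type_algebra_def)
  qed (auto simp: ring_of_type_algebra_def val_ring_closed algebra_simps)
  show "comm_monoid (val_subring v)"
    by (rule comm_monoidI) (auto simp: ring_of_type_algebra_def val_ring_closed algebra_simps)
qed (auto simp: ring_of_type_algebra_def algebra_simps)

lemma ideal_max_ideal: "ideal (max_ideal v) (val_subring v)"
proof -
  interpret R: cring "val_subring v" by (rule cring_val_subring)
  have inv: "\<ominus>\<^bsub>val_subring v\<^esub> x = - x" if "x \<in> val_ring v" for x
    using that val_ring_closed(3)[of x]
    by (intro R.minus_equality) (auto simp: ring_of_type_algebra_def)
  have sub: "max_ideal v \<subseteq> val_ring v"
    by (auto simp: max_ideal_def val_ring_def)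
  show ?thesis
  proof (rule idealI)
    show "ring (val_subring v)" by (rule R.ring_axioms)
    show "subgroup (max_ideal v) (add_monoid (val_subring v))"
    proof (rule R.add.subgroupI)
      show "max_ideal v \<subseteq> carrier (val_subring v)" using sub by simp
      show "max_ideal v \<noteq> {}" using max_ideal_closed(1) by auto
      show "\<ominus>\<^bsub>val_subring v\<^esub> a \<in> max_ideal v" if "a \<in> max_ideal v" for a
        using that sub inv[of a] max_ideal_closed(2)[of a] by auto
      show "a \<oplus>\<^bsub>val_subring v\<^esub> b \<in> max_ideal v" if "a \<in> max_ideal v" "b \<in> max_ideal v" for a b
        using that max_ideal_closed(3)[of a b] by (simp add: ring_of_type_algebra_def)
    qed
  qed (auto simp: ring_of_type_algebra_def max_ideal_closed mult.commute)
qed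

lemma proper_ideal_subset:
  assumes J: "ideal J (val_subring v)" and ne: "J \<noteq> carrier (val_subring v)"
  shows "J \<subseteq> max_ideal v"
proof
  interpret J: ideal J "val_subring v" by (rule J)
  fix x assume x: "x \<in> J"
  then have xR: "x \<in> val_ring v" using J.a_subset by auto
  show "x \<in> max_ideal v"
  proof (rule ccontr)
    assume "x \<notin> max_ideal v"
    then have v0: "v x = 0" using xR by (auto simp: max_ideal_def val_ring_def)
    then have x0: "x \<noteq> 0" by (auto simp: zero_with_infty_def)
    have "v (inverse x) = 0" using v0 val_inverse[of x 0] by (simp add: zero_with_infty_def)
    then have "inverse x \<in> carrier (val_subring v)" by (simp add: val_ring_def)
    from J.I_l_closed[OF x this] have "\<one>\<^bsub>val_subring v\<^esub> \<in> J"
      using x0 by (simp add: ring_of_type_algebra_def)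
    then show False using ne J.one_imp_carrier by simp
  qed
qed

text \<open>The set \<^const>\<open>max_ideal\<close> is the maximal ideal of the valuation ring, and the quotient is
  a field.\<close>

lemma maximalideal_iff: "maximalideal I (val_subring v) \<longleftrightarrow> I = max_ideal v"
proof -
  have ne: "max_ideal v \<noteq> carrier (val_subring v)"
  proof -
    have "1 \<notin> max_ideal v" by (simp add: max_ideal_def)
    then show ?thesis using val_ring_closed(2) by auto
  qed
  have max: "maximalideal (max_ideal v) (val_subring v)"
    using ideal_max_ideal ne proper_ideal_subset by (intro maximalidealI) auto
  moreover have "I = max_ideal v" if I: "maximalideal I (val_subring v)"
  proof -
    interpret I: maximalideal I "val_subring v" by (rule I)
    have "I \<subseteq> max_ideal v"
      using proper_ideal_subset[OF I.ideal_axioms] I.I_notcarr by simp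
    moreover have "max_ideal v \<subseteq> carrier (val_subring v)"
      by (auto simp: max_ideal_def val_ring_def)
    ultimately show ?thesis using I.I_maximal[OF ideal_max_ideal] ne by auto
  qed
  ultimately show ?thesis by blast
qed

lemma field_residue_field: "field (residue_field v)"
  unfolding residue_field_def
  using maximalideal.quotient_is_field[of "max_ideal v" "val_subring v"]
    cring_val_subring maximalideal_iff by blast

end

end

theory Submission
  imports Defs
begin

text \<open>Write \<open>B\<close> for \<open>R\<close> without 0, \<open>p\<close> for a point and \<open>~\<close> for the existence of a definable
  bijection between formal disjoint unions. Since \<open>R\<^sup>(\<^sup>1\<^sup>)\<close> is the disjoint union of \<open>1 + \<pi> R\<close> and
  \<open>\<pi>' R\<^sup>(\<^sup>1\<^sup>)\<close>, it absorbs a copy of \<open>R\<close>, whence \<open>B ~ 2 B + p\<close>. Comparing the decompositions of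
  \<open>K\<^sup>\<times>\<close> into cosets of \<open>P\<^sub>n\<close> and into translates of the range of an \<open>n\<close>-th root function by
  roots of unity gives \<open>K\<^sup>\<times> ~ \<lambda>\<^sub>n K\<^sup>\<times>\<close>, and \<open>H = \<int>\<close> turns these into \<open>K\<^sup>\<times> ~ 2 K\<^sup>\<times>\<close>, where
  \<open>K\<^sup>\<times> ~ 2 B\<close>. It remains to pass from \<open>2 B ~ 4 B\<close> to \<open>B ~ 2 B\<close>. As \<open>H\<close> contains an odd number,
  some \<open>\<lambda>\<^sub>n\<close> is even; then \<open>n\<close> is even and the characteristic is not 2, so the root function
  yields a definable set \<open>V\<close> of representatives of \<open>K\<^sup>\<times>\<close> up to sign. Any two such sets are in
  definable bijection. This gives \<open>V ~ B\<close> and, by doing the comparison above up to sign,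
  \<open>V ~ \<lambda>\<^sub>n V\<close>. Hence \<open>B ~ \<lambda>\<^sub>n B ~ 2 B\<close>, and so \<open>B ~ 2 B + p ~ B + p ~ R\<close>. Finally
  \<open>[A] = [A \<times> R] - [A \<times> B] = 0\<close> for every definable \<open>A\<close>.\<close>

section \<open>Definable predicates on assignments\<close>

fun rename_trm :: "(nat \<Rightarrow> nat) \<Rightarrow> 'f trm \<Rightarrow> 'f trm" where
  "rename_trm \<rho> (TVar i) = TVar (\<rho> i)"
| "rename_trm \<rho> TZero = TZero"
| "rename_trm \<rho> TOne = TOne"
| "rename_trm \<rho> (TAdd s t) = TAdd (rename_trm \<rho> s) (rename_trm \<rho> t)"
| "rename_trm \<rho> (TSub s t) = TSub (rename_trm \<rho> s) (rename_trm \<rho> t)"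
| "rename_trm \<rho> (TMul s t) = TMul (rename_trm \<rho> s) (rename_trm \<rho> t)"
| "rename_trm \<rho> (TFun f ts) = TFun f (map (rename_trm \<rho>) ts)"

text \<open>Under a quantifier the bound index 0 stays fixed and \<open>\<rho>\<close> is shifted by
  one. As \<open>\<rho>\<close> may identify variables, several variables that read one coordinate
  can later be merged into a single bound variable.\<close>

fun rename_fml :: "(nat \<Rightarrow> nat) \<Rightarrow> ('f, 'r) fml \<Rightarrow> ('f, 'r) fml" where
  "rename_fml \<rho> (FEq s t) = FEq (rename_trm \<rho> s) (rename_trm \<rho> t)"
| "rename_fml \<rho> (FRel r ts) = FRel r (map (rename_trm \<rho>) ts)"
| "rename_fml \<rho> (FNot \<phi>) = FNot (rename_fml \<rho> \<phi>)"
| "rename_fml \<rho> (FAnd \<phi> \<psi>) = FAnd (rename_fml \<rho> \<phi>) (rename_fml \<rho> \<psi>)"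
| "rename_fml \<rho> (FEx \<phi>) = FEx (rename_fml (case_nat 0 (\<lambda>i. Suc (\<rho> i))) \<phi>)"

lemma wf_rename_trm [simp]: "wf_trm L (rename_trm \<rho> t) \<longleftrightarrow> wf_trm L t"
  by (induction t) auto

lemma wf_rename_fml [simp]: "wf_fml L (rename_fml \<rho> \<phi>) \<longleftrightarrow> wf_fml L \<phi>"
  by (induction \<phi> arbitrary: \<rho>) auto

lemma eval_rename_trm [simp]: "eval_trm L e (rename_trm \<rho> t) = eval_trm L (\<lambda>i. e (\<rho> i)) t"
proof (induction t)
  case (TFun f ts)
  then have "map (eval_trm L e \<circ> rename_trm \<rho>) ts = map (eval_trm L (\<lambda>i. e (\<rho> i))) ts"
    by auto
  then show ?case by (simp only: rename_trm.simps eval_trm.simps map_map)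
qed auto

lemma sat_rename_fml [simp]: "sat L e (rename_fml \<rho> \<phi>) \<longleftrightarrow> sat L (\<lambda>i. e (\<rho> i)) \<phi>"
proof (induction \<phi> arbitrary: \<rho> e)
  case (FRel r ts)
  have "map (eval_trm L e \<circ> rename_trm \<rho>) ts = map (eval_trm L (\<lambda>i. e (\<rho> i))) ts"
    by auto
  then show ?case by (simp only: rename_fml.simps sat.simps map_map)
next
  case (FEx \<phi>)
  have "(\<lambda>i. case_nat a e (case_nat 0 (\<lambda>i. Suc (\<rho> i)) i)) = case_nat a (\<lambda>i. e (\<rho> i))" for a
    by (auto split: nat.split)
  then show ?case using FEx by simp
qed auto

section \<open>Closure properties of definable predicates\<close>

fun var_or_par :: "(nat \<Rightarrow> 'a) \<Rightarrow> nat + 'a \<Rightarrow> 'a" where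
  "var_or_par e (Inl j) = e j"
| "var_or_par e (Inr a) = a"

text \<open>Unlike in \<^const>\<open>definable\<close>, the arity is not fixed: \<open>s\<close> tells which variables of the
  formula stand for coordinates of the assignment and which for parameters, so that definable
  predicates can be combined without renumbering.\<close>

definition definable_pred :: "('f, 'r, 'a::field) ring_expansion \<Rightarrow> ((nat \<Rightarrow> 'a) \<Rightarrow> bool) \<Rightarrow> bool" where
  "definable_pred L P \<longleftrightarrow>
     (\<exists>\<phi> s. wf_fml L \<phi> \<and> (\<forall>e. P e \<longleftrightarrow> sat L (\<lambda>i. var_or_par e (s i)) \<phi>))"

lemma definable_predI:
  assumes "wf_fml L \<phi>" "\<And>e. P e \<longleftrightarrow> sat L (\<lambda>i. var_or_par e (s i)) \<phi>"
  shows "definable_pred L P"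
  using assms unfolding definable_pred_def by blast

lemma definable_pred_not:
  assumes "definable_pred L P"
  shows "definable_pred L (\<lambda>e. \<not> P e)"
proof -
  obtain \<phi> s where "wf_fml L \<phi>" "\<And>e. P e \<longleftrightarrow> sat L (\<lambda>i. var_or_par e (s i)) \<phi>"
    using assms unfolding definable_pred_def by blast
  then show ?thesis by (intro definable_predI[of _ "FNot \<phi>" _ s]) auto
qed

lemma definable_pred_conj:
  assumes "definable_pred L P" "definable_pred L Q"
  shows "definable_pred L (\<lambda>e. P e \<and> Q e)"
proof -
  obtain \<phi> s where 1: "wf_fml L \<phi>" "\<And>e. P e \<longleftrightarrow> sat L (\<lambda>i. var_or_par e (s i)) \<phi>"
    using assms unfolding definable_pred_def by blast
  obtain \<psi> t where 2: "wf_fml L \<psi>" "\<And>e. Q e \<longleftrightarrow> sat L (\<lambda>i. var_or_par e (t i)) \<psi>"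
    using assms unfolding definable_pred_def by blast
  \<comment> \<open>Both formulas may use the same variable for different purposes, so the variables
    of \<open>\<phi>\<close> move to even indices and those of \<open>\<psi>\<close> to odd
    ones.\<close>
  show ?thesis
    by (rule definable_predI[of _ "FAnd (rename_fml (\<lambda>i. 2 * i) \<phi>) (rename_fml (\<lambda>i. 2 * i + 1) \<psi>)" _
          "\<lambda>i. if even i then s (i div 2) else t (i div 2)"]) (simp_all add: 1 2)
qed

lemma definable_pred_disj:
  assumes "definable_pred L P" "definable_pred L Q"
  shows "definable_pred L (\<lambda>e. P e \<or> Q e)"
  using definable_pred_not[OF definable_pred_conj[OF assms[THEN definable_pred_not]]] by simp

lemma definable_pred_ex:
  assumes "definable_pred L (\<lambda>e. P (e 0) (\<lambda>i. e (Suc i)))"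
  shows "definable_pred (L :: ('f, 'r, 'a::field) ring_expansion) (\<lambda>e. \<exists>x. P x e)"
proof -
  obtain \<phi> s where 1: "wf_fml L \<phi>"
    "\<And>e. P (e 0) (\<lambda>i. e (Suc i)) \<longleftrightarrow> sat L (\<lambda>i. var_or_par e (s i)) \<phi>"
    using assms unfolding definable_pred_def by blast
  \<comment> \<open>Every variable that reads coordinate 0 becomes the bound variable, and the
    others move up by one. In \<open>u\<close> the remaining coordinates drop by one; where
    \<open>s i\<close> is \<open>Inl 0\<close> the value \<open>u i\<close> is never read, since
    \<open>\<rho> i\<close> is 0 there.\<close>
  define \<rho> where "\<rho> i = (if s i = Inl 0 then 0 else Suc i)" for i
  define u :: "nat \<Rightarrow> nat + 'a" where "u i = (case s i of Inl j \<Rightarrow> Inl (j - 1) | Inr a \<Rightarrow> Inr a)" for i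
  have eq: "(\<lambda>i. case_nat a (\<lambda>i. var_or_par e (u i)) (\<rho> i)) = (\<lambda>i. var_or_par (case_nat a e) (s i))"
    for a :: 'a and e :: "nat \<Rightarrow> 'a"
    by (auto simp: \<rho>_def u_def fun_eq_iff split: sum.split nat.split)
  have 2: "P a e \<longleftrightarrow> sat L (\<lambda>i. var_or_par (case_nat a e) (s i)) \<phi>" for a e
    using 1(2)[of "case_nat a e"] by simp
  show ?thesis
    by (rule definable_predI[of _ "FEx (rename_fml \<rho> \<phi>)" _ u]) (simp_all add: 1(1) eq 2)
qed

lemma definable_pred_subst:
  assumes "definable_pred L P"
  shows "definable_pred L (\<lambda>e. P (\<lambda>j. var_or_par e (t j)))"
proof -
  obtain \<phi> s where 1: "wf_fml L \<phi>" "\<And>e. P e \<longleftrightarrow> sat L (\<lambda>i. var_or_par e (s i)) \<phi>"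
    using assms unfolding definable_pred_def by blast
  define u where "u i = (case s i of Inl j \<Rightarrow> t j | Inr a \<Rightarrow> Inr a)" for i
  have "(\<lambda>i. var_or_par (\<lambda>j. var_or_par e (t j)) (s i)) = (\<lambda>i. var_or_par e (u i))" for e
    by (auto simp: u_def fun_eq_iff split: sum.split)
  then show ?thesis
    using 1 by (intro definable_predI[of _ \<phi> _ u]) auto
qed

lemma definable_pred_reindex:
  assumes "definable_pred L P"
  shows "definable_pred L (\<lambda>e. P (\<lambda>j. e (t j)))"
  using definable_pred_subst[OF assms, of "\<lambda>j. Inl (t j)"] by simp

lemma definable_pred_all_less:
  assumes "\<And>i. i < n \<Longrightarrow> definable_pred L (P i)"
  shows "definable_pred L (\<lambda>e. \<forall>i<(n::nat). P i e)"
  using assms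
proof (induction n)
  case 0
  show ?case by (rule definable_predI[of _ "FEq TZero TZero"]) auto
next
  case (Suc n)
  have "definable_pred L (\<lambda>e. P n e \<and> (\<forall>i<n. P i e))"
    by (intro definable_pred_conj Suc) auto
  then show ?case by (simp add: All_less_Suc)
qed

text \<open>A term in the semantic sense: any function of the assignment whose graph is definable,
  with the value stored at coordinate 0. It need not be given by a term of the language.\<close>

definition definable_trm :: "('f, 'r, 'a::field) ring_expansion \<Rightarrow> ((nat \<Rightarrow> 'a) \<Rightarrow> 'a) \<Rightarrow> bool" where
  "definable_trm L t \<longleftrightarrow> definable_pred L (\<lambda>e. e 0 = t (\<lambda>i. e (Suc i)))"

text \<open>The term enters through a quantified variable that is required to equal it, which avoids
  syntactic substitution under binders.\<close>

lemma definable_pred_inst: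
  assumes "definable_pred L (\<lambda>e. Q (e 0) (\<lambda>i. e (Suc i)))" "definable_trm L t"
  shows "definable_pred L (\<lambda>e. Q (t e) e)"
proof -
  have "definable_pred L (\<lambda>e. \<exists>x. x = t e \<and> Q x e)"
    by (intro definable_pred_ex definable_pred_conj assms(1) assms(2)[unfolded definable_trm_def])
  then show ?thesis by simp
qed

lemma definable_trm_var: "definable_trm L (\<lambda>e. e i)"
  unfolding definable_trm_def
  by (rule definable_predI[of _ "FEq (TVar 0) (TVar 1)" _ "case_nat (Inl 0) (\<lambda>_. Inl (Suc i))"]) auto

lemma definable_trm_const: "definable_trm L (\<lambda>e. c)"
  unfolding definable_trm_def
  by (rule definable_predI[of _ "FEq (TVar 0) (TVar 1)" _ "case_nat (Inl 0) (\<lambda>_. Inr c)"]) auto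

lemma definable_trm_shift:
  assumes "definable_trm L t"
  shows "definable_trm L (\<lambda>e. t (\<lambda>i. e (\<rho> i)))"
  using definable_pred_reindex[OF assms[unfolded definable_trm_def], of "case_nat 0 (\<lambda>i. Suc (\<rho> i))"]
  unfolding definable_trm_def by simp

lemma definable_pred_eq:
  assumes "definable_trm L t" "definable_trm L u"
  shows "definable_pred L (\<lambda>e. t e = u e)"
  by (rule definable_pred_inst[where Q="\<lambda>x e. x = u e", OF _ assms(1)])
     (rule assms(2)[unfolded definable_trm_def])

lemma definable_trm_binop:
  assumes op: "definable_pred L (\<lambda>e. e 0 = op (e 1) (e 2))"
    and t: "definable_trm L t" and u: "definable_trm L u"
  shows "definable_trm L (\<lambda>e. op (t e) (u e))"
proof -
  \<comment> \<open>Instantiation acts on coordinate 0 only. Reversing the three coordinates brings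
    the second argument there; after it is replaced by \<open>u\<close>, the first argument has
    moved to coordinate 0.\<close>
  have "definable_pred L (\<lambda>e. e (Suc (Suc 0)) = op (e (Suc 0)) (e 0))"
    using definable_pred_reindex[OF op, of "\<lambda>j. 2 - j"] by (simp add: numeral_2_eq_2)
  then have "definable_pred L (\<lambda>e. e 1 = op (e 0) (u (\<lambda>i. e (Suc (Suc i)))))"
    using definable_pred_inst[where Q="\<lambda>x e. e 1 = op (e 0) x" and
        t="\<lambda>e. u (\<lambda>i. e (Suc (Suc i)))" and L=L] definable_trm_shift[OF u] by simp
  then have "definable_pred L (\<lambda>e. e 0 = op (t (\<lambda>i. e (Suc i))) (u (\<lambda>i. e (Suc i))))"
    using definable_pred_inst[where Q="\<lambda>x e. e 0 = op x (u (\<lambda>i. e (Suc i)))" and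
        t="\<lambda>e. t (\<lambda>i. e (Suc i))" and L=L] definable_trm_shift[OF t] by simp
  then show ?thesis by (simp add: definable_trm_def)
qed

lemma definable_trm_add:
  assumes "definable_trm L t" "definable_trm L u"
  shows "definable_trm L (\<lambda>e. t e + u e)"
  by (rule definable_trm_binop[OF _ assms],
      rule definable_predI[of _ "FEq (TVar 0) (TAdd (TVar 1) (TVar 2))" _ Inl]) auto

lemma definable_trm_mult:
  assumes "definable_trm L t" "definable_trm L u"
  shows "definable_trm L (\<lambda>e. t e * u e)"
  by (rule definable_trm_binop[OF _ assms],
      rule definable_predI[of _ "FEq (TVar 0) (TMul (TVar 1) (TVar 2))" _ Inl]) auto

lemma definable_trm_power:
  assumes "definable_trm L t"
  shows "definable_trm L (\<lambda>e. t e ^ n)"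
  by (induction n) (auto intro: definable_trm_const definable_trm_mult assms)

lemma definable_trm_uminus:
  assumes "definable_trm L t"
  shows "definable_trm L (\<lambda>e. - t e)"
  using definable_trm_mult[OF definable_trm_const[of L "- 1"] assms] by simp

lemma definable_pred_True: "definable_pred L (\<lambda>e. True)"
  by (rule definable_predI[of _ "FEq TZero TZero"]) auto

lemma definable_pred_False: "definable_pred L (\<lambda>e. False)"
  using definable_pred_not[OF definable_pred_True] by simp

section \<open>Comparison with definable subsets of powers of the field\<close>

lemma definable_imp_definable_pred:
  assumes "definable L n D"
  shows "definable_pred L (\<lambda>e. map e [0..<n] \<in> D)" "\<And>xs. xs \<in> D \<Longrightarrow> length xs = n"
proof -
  obtain \<phi> p where 1: "wf_fml L \<phi>"
    "D = {xs. length xs = n \<and> sat L (\<lambda>i. if i < n then xs ! i else p (i - n)) \<phi>}"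
    using assms unfolding definable_def by blast
  have "(\<lambda>i. if i < n then map e [0..<n] ! i else p (i - n)) =
      (\<lambda>i. var_or_par e (if i < n then Inl i else Inr (p (i - n))))" for e
    by auto
  then show "definable_pred L (\<lambda>e. map e [0..<n] \<in> D)"
    by (intro definable_predI[OF 1(1)]) (simp add: 1(2))
  show "\<And>xs. xs \<in> D \<Longrightarrow> length xs = n" using 1(2) by auto
qed

lemma definable_pred_imp_definable:
  assumes "definable_pred L P"
    and D: "\<And>xs. xs \<in> D \<longleftrightarrow> length xs = n \<and> P (\<lambda>i. if i < n then xs ! i else 0)"
  shows "definable L n D"
proof -
  obtain \<phi> s where 1: "wf_fml L \<phi>" "\<And>e. P e \<longleftrightarrow> sat L (\<lambda>i. var_or_par e (s i)) \<phi>"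
    using assms(1) unfolding definable_pred_def by blast
  \<comment> \<open>A variable reading a coordinate below \<open>n\<close> keeps pointing at it; any
    other variable \<open>i\<close> gets its own parameter slot \<open>n + i\<close>. A coordinate
    from \<open>n\<close> on becomes the parameter 0, matching the default value of the assignment
    in the hypothesis on \<open>D\<close>.\<close>
  define \<rho> where "\<rho> i = (case s i of Inl j \<Rightarrow> if j < n then j else n + i | Inr a \<Rightarrow> n + i)" for i
  define p where "p i = (case s i of Inl j \<Rightarrow> 0 | Inr a \<Rightarrow> a)" for i
  have eq: "(\<lambda>i. if \<rho> i < n then xs ! \<rho> i else p (\<rho> i - n)) =
      (\<lambda>i. var_or_par (\<lambda>i. if i < n then xs ! i else 0) (s i))" for xs
    by (auto simp: \<rho>_def p_def fun_eq_iff split: sum.splits)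
  show ?thesis unfolding definable_def
    by (rule exI[of _ "rename_fml \<rho> \<phi>"], rule exI[of _ p]) (auto simp: D 1 eq)
qed

section \<open>Definable subsets of the line\<close>

definition definable_subset :: "('f, 'r, 'a::field) ring_expansion \<Rightarrow> 'a set \<Rightarrow> bool" where
  "definable_subset L A \<longleftrightarrow> definable_pred L (\<lambda>e. e 0 \<in> A)"

definition definable_fun :: "('f, 'r, 'a::field) ring_expansion \<Rightarrow> ('a \<Rightarrow> 'a) \<Rightarrow> 'a set \<Rightarrow> bool" where
  "definable_fun L f A \<longleftrightarrow> definable_pred L (\<lambda>e. e 0 \<in> A \<and> e 1 = f (e 0))"

definition def_iso :: "('f, 'r, 'a::field) ring_expansion \<Rightarrow> 'a set \<Rightarrow> 'a set \<Rightarrow> bool" where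
  "def_iso L A B \<longleftrightarrow> definable_subset L A \<and> definable_subset L B \<and>
     (\<exists>f. bij_betw f A B \<and> definable_fun L f A)"

lemma definable_pred_mem:
  assumes "definable_subset L A" "definable_trm L t"
  shows "definable_pred L (\<lambda>e. t e \<in> A)"
  by (rule definable_pred_inst[where Q="\<lambda>x e. x \<in> A", OF _ assms(2)])
     (use assms(1) in \<open>simp add: definable_subset_def\<close>)

lemma definable_pred_graph:
  assumes "definable_fun L f A" "definable_trm L t" "definable_trm L u"
  shows "definable_pred L (\<lambda>e. t e \<in> A \<and> u e = f (t e))"
proof -
  have 1: "definable_pred L (\<lambda>e. e 1 \<in> A \<and> e 0 = f (e 1))"
    using definable_pred_reindex[OF assms(1)[unfolded definable_fun_def], of "\<lambda>j. 1 - j"] by simp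
  have "definable_pred L (\<lambda>e. e 0 \<in> A \<and> u (\<lambda>i. e (Suc i)) = f (e 0))"
    by (rule definable_pred_inst[where Q="\<lambda>x e. e 0 \<in> A \<and> x = f (e 0)"])
       (use 1 definable_trm_shift[OF assms(3), of Suc] in auto)
  then show ?thesis
    by (rule definable_pred_inst[where Q="\<lambda>x e. x \<in> A \<and> u e = f x", OF _ assms(2)])
qed

lemmas definable_intros =
  definable_pred_mem definable_pred_not definable_pred_conj definable_pred_disj definable_pred_ex
  definable_pred_eq definable_pred_True definable_pred_False definable_trm_var
  definable_trm_add definable_trm_mult definable_trm_power definable_trm_uminus definable_trm_const

lemma definable_fun_trm:
  assumes "definable_subset L A" "definable_trm L (\<lambda>e. f (e 0))"
  shows "definable_fun L f A"
  unfolding definable_fun_def by (intro definable_intros assms)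

lemma definable_subset_Un:
  assumes "definable_subset L A" "definable_subset L B"
  shows "definable_subset L (A \<union> B)"
  unfolding definable_subset_def Un_iff by (intro definable_intros assms)

lemma definable_subset_Int:
  assumes "definable_subset L A" "definable_subset L B"
  shows "definable_subset L (A \<inter> B)"
  unfolding definable_subset_def Int_iff by (intro definable_intros assms)

lemma definable_subset_Diff:
  assumes "definable_subset L A" "definable_subset L B"
  shows "definable_subset L (A - B)"
  unfolding definable_subset_def Diff_iff by (intro definable_intros assms)

lemma definable_subset_empty: "definable_subset L {}"
  unfolding definable_subset_def empty_iff by (intro definable_intros)

lemma definable_subset_UNIV: "definable_subset L UNIV"
  unfolding definable_subset_def by (simp add: definable_pred_True)

lemma definable_subset_singleton: "definable_subset L {c}"
  unfolding definable_subset_def singleton_iff by (intro definable_intros)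

lemma definable_subset_UN:
  assumes "finite I" "\<And>i. i \<in> I \<Longrightarrow> definable_subset L (A i)"
  shows "definable_subset L (\<Union>i\<in>I. A i)"
  using assms
  by (induction I rule: finite_induct) (auto intro!: definable_subset_empty definable_subset_Un)

lemma definable_fun_subset:
  assumes "definable_fun L f A" "B \<subseteq> A" "definable_subset L B"
  shows "definable_fun L f B"
proof -
  have eq: "(e 0 \<in> B \<and> e 1 = f (e 0)) = (e 0 \<in> B \<and> e 0 \<in> A \<and> e 1 = f (e 0))" for e :: "nat \<Rightarrow> _"
    using assms(2) by auto
  show ?thesis
    unfolding definable_fun_def eq
    by (intro definable_pred_conj definable_pred_mem definable_pred_graph assms(1,3) definable_trm_var)
qed

lemma definable_subset_image:
  assumes "definable_fun L f A" "B \<subseteq> A" "definable_subset L B"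
  shows "definable_subset L (f ` B)"
proof -
  have eq: "(e 0 \<in> f ` B) = (\<exists>x. x \<in> B \<and> e 0 = f x)" for e :: "nat \<Rightarrow> _"
    by auto
  show ?thesis
    unfolding definable_subset_def eq
    by (intro definable_pred_ex definable_pred_graph definable_fun_subset[OF assms] definable_trm_var)
qed

section \<open>Definable bijections between subsets of the line\<close>

lemma def_isoI:
  assumes "definable_fun L f A" "B \<subseteq> A" "definable_subset L B" "inj_on f B" "f ` B = C"
  shows "def_iso L B C"
  unfolding def_iso_def
  using assms definable_subset_image[OF assms(1-3)] definable_fun_subset[OF assms(1-3)]
  by (auto simp: bij_betw_def)

lemma def_iso_definable: "def_iso L A B \<Longrightarrow> definable_subset L A" "def_iso L A B \<Longrightarrow> definable_subset L B"
  by (auto simp: def_iso_def)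

lemma def_iso_refl:
  assumes "definable_subset L A"
  shows "def_iso L A A"
  by (rule def_isoI[of _ "\<lambda>x. x" A]) (auto intro!: definable_fun_trm definable_intros assms)

lemma def_iso_sym:
  assumes "def_iso (L :: ('f, 'r, 'a::field) ring_expansion) A B"
  shows "def_iso L B A"
proof -
  obtain f where f: "bij_betw f A B" "definable_fun L f A" and A: "definable_subset L A" "definable_subset L B"
    using assms unfolding def_iso_def by auto
  have eq: "(e 0 \<in> B \<and> e 1 = inv_into A f (e 0)) = (e 1 \<in> A \<and> e 0 = f (e 1))" for e :: "nat \<Rightarrow> 'a"
    using f(1) by (auto simp: bij_betw_def inv_into_into)
  have "definable_fun L (inv_into A f) B"
    unfolding definable_fun_def eq by (intro definable_pred_graph f(2) definable_trm_var)
  then show ?thesis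
    using bij_betw_inv_into[OF f(1)] A unfolding def_iso_def by blast
qed

lemma def_iso_trans [trans]:
  assumes "def_iso (L :: ('f, 'r, 'a::field) ring_expansion) A B" "def_iso L B C"
  shows "def_iso L A C"
proof -
  obtain f where f: "bij_betw f A B" "definable_fun L f A"
    using assms(1) unfolding def_iso_def by auto
  obtain g where g: "bij_betw g B C" "definable_fun L g B"
    using assms(2) unfolding def_iso_def by auto
  have eq: "(e 0 \<in> A \<and> e 1 = (g \<circ> f) (e 0)) = (\<exists>y. (e 0 \<in> A \<and> y = f (e 0)) \<and> (y \<in> B \<and> e 1 = g y))"
    for e :: "nat \<Rightarrow> 'a"
    using f(1) by (auto simp: bij_betw_def)
  have "definable_fun L (g \<circ> f) A"
    unfolding definable_fun_def eq
    by (intro definable_pred_ex definable_pred_conj definable_pred_graph[OF f(2)]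
        definable_pred_graph[OF g(2)] definable_trm_var)
  then show ?thesis
    using bij_betw_trans[OF f(1) g(1)] def_iso_definable[OF assms(1)] def_iso_definable[OF assms(2)]
    unfolding def_iso_def by blast
qed

lemma def_iso_Un:
  assumes "def_iso L A B" "def_iso L A' B'" "A \<inter> A' = {}" "B \<inter> B' = {}"
  shows "def_iso L (A \<union> A') (B \<union> B')"
proof -
  obtain f where f: "bij_betw f A B" "definable_fun L f A"
    using assms(1) unfolding def_iso_def by auto
  obtain g where g: "bij_betw g A' B'" "definable_fun L g A'"
    using assms(2) unfolding def_iso_def by auto
  define h where "h x = (if x \<in> A then f x else g x)" for x
  have "bij_betw h A B" using f(1) by (subst bij_betw_cong[of A h f]) (auto simp: h_def)
  moreover have "bij_betw h A' B'"
    using g(1) assms(3) by (subst bij_betw_cong[of A' h g]) (auto simp: h_def)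
  ultimately have "bij_betw h (A \<union> A') (B \<union> B')"
    using assms(4) by (rule bij_betw_combine)
  moreover have eq: "(e 0 \<in> A \<union> A' \<and> e 1 = h (e 0)) =
      ((e 0 \<in> A \<and> e 1 = f (e 0)) \<or> (e 0 \<in> A' \<and> e 1 = g (e 0)))" for e :: "nat \<Rightarrow> _"
    using assms(3) by (auto simp: h_def)
  then have "definable_fun L h (A \<union> A')"
    unfolding definable_fun_def eq
    by (intro definable_pred_disj definable_pred_graph[OF f(2)] definable_pred_graph[OF g(2)]
        definable_trm_var)
  ultimately show ?thesis
    using def_iso_definable[OF assms(1)] def_iso_definable[OF assms(2)] definable_subset_Un
    unfolding def_iso_def by blast
qed

lemma definable_pts_iff: "definable L 1 (pts A) \<longleftrightarrow> definable_subset L A"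
proof
  assume "definable L 1 (pts A)"
  from definable_imp_definable_pred(1)[OF this] show "definable_subset L A"
    by (simp add: definable_subset_def pts_def image_iff)
next
  assume "definable_subset L A"
  then show "definable L 1 (pts A)"
    unfolding definable_subset_def
    by (rule definable_pred_imp_definable) (auto simp: pts_def length_Suc_conv)
qed

lemma definable_graph_imp_definable_fun:
  assumes "definable L 2 {[x, f x] | x. x \<in> A}"
  shows "definable_fun L f A"
proof -
  have "map e [0..<2] \<in> {[x, f x] | x. x \<in> A} \<longleftrightarrow> e 0 \<in> A \<and> e 1 = f (e 0)" for e
    by (auto simp: numeral_2_eq_2)
  then show ?thesis
    using definable_imp_definable_pred(1)[OF assms] by (simp add: definable_fun_def)
qed

lemma def_iso_imp_definable_bij:
  assumes "def_iso L A B"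
  shows "definable_bij L (pts A) (pts B)"
proof -
  obtain f where f: "bij_betw f A B" "definable_fun L f A"
    using assms unfolding def_iso_def by auto
  let ?F = "\<lambda>xs. [f (hd xs)]"
  have "bij_betw ?F (pts A) (pts B)"
    using f(1) by (force simp: bij_betw_def pts_def inj_on_def)
  moreover have "definable L (1 + 1) {xs @ ?F xs | xs. xs \<in> pts A}"
    using f(2) unfolding definable_fun_def
    by (rule definable_pred_imp_definable) (auto simp: pts_def length_Suc_conv)
  ultimately show ?thesis
    unfolding definable_bij_def
    using def_iso_definable[OF assms] definable_pts_iff[of L A] definable_pts_iff[of L B]
    by (intro exI[of _ 1] conjI exI[of _ ?F]) simp_all
qed

section \<open>Equidecomposability\<close>

text \<open>Two definable injections with disjoint ranges allow us to form disjoint unions, and hence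
  definable bijections between finite multisets of definable subsets, without leaving the line.\<close>

locale line_doubling =
  fixes L :: "('f, 'r, 'a::field) ring_expansion" and g1 g2 :: "'a \<Rightarrow> 'a"
  assumes g: "definable_fun L g1 UNIV" "definable_fun L g2 UNIV" "inj g1" "inj g2"
    and disj: "range g1 \<inter> range g2 = {}"
begin

section \<open>Formal disjoint unions inside the line\<close>

definition dunion :: "'a set \<Rightarrow> 'a set \<Rightarrow> 'a set" where
  "dunion A B = g1 ` A \<union> g2 ` B"

lemma g_simps [simp]:
  "g1 x = g1 y \<longleftrightarrow> x = y" "g2 x = g2 y \<longleftrightarrow> x = y" "g1 x \<noteq> g2 y" "g2 y \<noteq> g1 x"
  using g(3,4) disj by (simp_all add: inj_eq) (metis disjoint_iff rangeI)+

lemma iso_image_g: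
  assumes "definable_subset L A"
  shows "def_iso L A (g1 ` A)" "def_iso L A (g2 ` A)"
  by (rule def_isoI[OF g(1) subset_UNIV assms]; simp add: inj_on_def)
     (rule def_isoI[OF g(2) subset_UNIV assms]; simp add: inj_on_def)

lemma iso_image_gI:
  assumes "def_iso L A B"
  shows "def_iso L A (g1 ` B)" "def_iso L A (g2 ` B)" "def_iso L (g1 ` A) B" "def_iso L (g2 ` A) B"
  by (rule def_iso_trans[OF assms iso_image_g(1)] def_iso_trans[OF assms iso_image_g(2)]
      def_iso_trans[OF def_iso_sym[OF iso_image_g(1)] assms]
      def_iso_trans[OF def_iso_sym[OF iso_image_g(2)] assms], rule def_iso_definable[OF assms])+

lemma definable_dunion:
  "definable_subset L A \<Longrightarrow> definable_subset L B \<Longrightarrow> definable_subset L (dunion A B)"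
  unfolding dunion_def by (intro definable_subset_Un iso_image_g[THEN def_iso_definable(2)])

lemma dunion_cong:
  assumes "def_iso L A A'" "def_iso L B B'"
  shows "def_iso L (dunion A B) (dunion A' B')"
  unfolding dunion_def
  by (intro def_iso_Un iso_image_gI assms) auto

lemma dunion_left_commute:
  assumes "definable_subset L A" "definable_subset L B" "definable_subset L C"
  shows "def_iso L (dunion A (dunion B C)) (dunion B (dunion A C))"
  unfolding dunion_def image_Un Un_assoc[symmetric]
  \<comment> \<open>Swapping two pieces on the left puts the images of \<open>B\<close>,
    \<open>A\<close> and \<open>C\<close> in the order in which they occur on the right, so that
    they are matched one by one.\<close>
  unfolding Un_commute[of "g1 ` A" "g2 ` g1 ` B"]
  by (intro def_iso_Un iso_image_gI def_iso_refl assms)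
     auto

lemma dunion_assoc:
  assumes "definable_subset L A" "definable_subset L B" "definable_subset L C"
  shows "def_iso L (dunion (dunion A B) C) (dunion A (dunion B C))"
  unfolding dunion_def image_Un Un_assoc[symmetric]
  by (intro def_iso_Un iso_image_gI def_iso_refl assms)
     auto

lemma dunion_empty: "definable_subset L A \<Longrightarrow> def_iso L (dunion {} A) A"
  unfolding dunion_def by (simp add: iso_image_gI def_iso_refl)

lemma dunion_single: "definable_subset L A \<Longrightarrow> def_iso L (dunion A {}) A"
  unfolding dunion_def by (simp add: iso_image_gI def_iso_refl)

lemma dunion_disjoint:
  assumes "definable_subset L A" "definable_subset L B" "A \<inter> B = {}"
  shows "def_iso L (A \<union> B) (dunion A B)"
  unfolding dunion_def by (intro def_iso_Un iso_image_g assms) auto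

text \<open>The nested union depends on the order of its members, though only up to definable
  bijection. Hence \<open>enc\<close> takes a list, and multisets come in afterwards.\<close>

fun enc :: "'a set list \<Rightarrow> 'a set" where
  "enc [] = {}"
| "enc (A # As) = dunion A (enc As)"

lemma definable_enc:
  "(\<And>A. A \<in> set As \<Longrightarrow> definable_subset L A) \<Longrightarrow> definable_subset L (enc As)"
proof (induction As)
  case Nil
  show ?case by (simp add: definable_subset_empty)
next
  case (Cons A As)
  then show ?case by (simp add: definable_dunion)
qed

text \<open>The set \<open>C\<close> reaches the front by one left commutation for each member of
  \<open>As\<close> that it passes.\<close>

lemma enc_insert:
  assumes "\<And>A. A \<in> set (As @ C # Bs) \<Longrightarrow> definable_subset L A"
  shows "def_iso L (enc (As @ C # Bs)) (enc (C # As @ Bs))"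
  using assms
proof (induction As)
  case Nil
  then have "definable_subset L (enc (C # Bs))" by (intro definable_enc) simp
  then show ?case unfolding append_Nil by (rule def_iso_refl)
next
  case (Cons A As)
  have d: "definable_subset L A" "definable_subset L C" "definable_subset L (enc (As @ Bs))"
    by (simp_all add: Cons.prems) (rule definable_enc, simp add: Cons.prems)
  have "def_iso L (enc (As @ C # Bs)) (dunion C (enc (As @ Bs)))"
    unfolding enc.simps[symmetric] by (rule Cons.IH) (simp add: Cons.prems)
  then have "def_iso L (enc (A # As @ C # Bs)) (dunion A (dunion C (enc (As @ Bs))))"
    unfolding enc.simps by (intro dunion_cong def_iso_refl d)
  also have "def_iso L \<dots> (dunion C (dunion A (enc (As @ Bs))))"
    using d by (rule dunion_left_commute)
  finally show ?case by simp
qed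

text \<open>The head of \<open>As\<close> occurs somewhere in \<open>Bs\<close> and can be pulled to
  the front there; the remaining lists again have equal multisets.\<close>

lemma enc_mset_eq:
  assumes "mset As = mset Bs" "\<And>A. A \<in> set As \<Longrightarrow> definable_subset L A"
  shows "def_iso L (enc As) (enc Bs)"
  using assms
proof (induction As arbitrary: Bs)
  case Nil
  then show ?case by (simp add: def_iso_refl definable_subset_empty)
next
  case (Cons A As)
  have "A \<in> set Bs" using Cons.prems(1) by (metis list.set_intros(1) set_mset_mset)
  then obtain B1 B2 where B: "Bs = B1 @ A # B2" by (meson split_list)
  have s: "set Bs = insert A (set As)" using Cons.prems(1) by (metis list.simps(15) set_mset_mset)
  have "def_iso L (enc As) (enc (B1 @ B2))"
    using Cons.prems B by (intro Cons.IH) auto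
  then have "def_iso L (enc (A # As)) (dunion A (enc (B1 @ B2)))"
    unfolding enc.simps using Cons.prems(2) by (intro dunion_cong def_iso_refl) auto
  moreover have "def_iso L (enc Bs) (enc (A # B1 @ B2))"
    unfolding B by (rule enc_insert) (use Cons.prems(2) s B in auto)
  then have "def_iso L (enc (A # B1 @ B2)) (enc Bs)" by (rule def_iso_sym)
  ultimately show ?case unfolding enc.simps by (rule def_iso_trans)
qed

lemma enc_append:
  assumes "\<And>A. A \<in> set (As @ Bs) \<Longrightarrow> definable_subset L A"
  shows "def_iso L (enc (As @ Bs)) (dunion (enc As) (enc Bs))"
  using assms
proof (induction As)
  case Nil
  then have "definable_subset L (enc Bs)" by (intro definable_enc) simp
  then show ?case unfolding append_Nil enc.simps by (rule def_iso_sym[OF dunion_empty])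
next
  case (Cons A As)
  have d: "definable_subset L A" "definable_subset L (enc As)" "definable_subset L (enc Bs)"
    by (simp add: Cons.prems) (rule definable_enc, simp add: Cons.prems)+
  have "def_iso L (enc (As @ Bs)) (dunion (enc As) (enc Bs))"
    by (rule Cons.IH) (simp add: Cons.prems)
  then have "def_iso L (enc (A # As @ Bs)) (dunion A (dunion (enc As) (enc Bs)))"
    unfolding enc.simps by (intro dunion_cong def_iso_refl d)
  also have "def_iso L \<dots> (dunion (dunion A (enc As)) (enc Bs))"
    using d by (intro def_iso_sym[OF dunion_assoc])
  finally show ?case by simp
qed

text \<open>Equality of finite formal sums of definable subsets of the line, witnessed by an actual
  definable bijection. Unlike in the Grothendieck group, nothing may be cancelled. By
  \<open>enc_mset_eq\<close> the choice of enumerations is immaterial.\<close>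

definition equidec :: "'a set multiset \<Rightarrow> 'a set multiset \<Rightarrow> bool" (infix "\<asymp>" 50) where
  "M \<asymp> N \<longleftrightarrow> (\<forall>A\<in>#M + N. definable_subset L A) \<and>
     (\<exists>As Bs. mset As = M \<and> mset Bs = N \<and> def_iso L (enc As) (enc Bs))"

lemma equidecI:
  assumes "def_iso L (enc As) (enc Bs)" "\<And>A. A \<in> set As \<union> set Bs \<Longrightarrow> definable_subset L A"
  shows "mset As \<asymp> mset Bs"
  using assms unfolding equidec_def by auto

lemma equidec_encD:
  assumes "mset As \<asymp> mset Bs"
  shows "def_iso L (enc As) (enc Bs)"
proof -
  obtain As' Bs' where *: "mset As' = mset As" "mset Bs' = mset Bs" "def_iso L (enc As') (enc Bs')"
    and d: "\<And>A. A \<in> set As \<union> set Bs \<Longrightarrow> definable_subset L A"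
    using assms unfolding equidec_def by auto
  have "def_iso L (enc As) (enc As')" "def_iso L (enc Bs) (enc Bs')"
    by (rule enc_mset_eq; simp add: * d)+
  then show ?thesis using def_iso_trans[OF _ def_iso_trans[OF *(3) def_iso_sym]] by blast
qed

lemma equidec_definable: "M \<asymp> N \<Longrightarrow> A \<in># M + N \<Longrightarrow> definable_subset L A"
  unfolding equidec_def by auto

lemma equidec_refl:
  assumes "\<And>A. A \<in># M \<Longrightarrow> definable_subset L A"
  shows "M \<asymp> M"
proof -
  obtain As where "mset As = M" using ex_mset by blast
  then show ?thesis
    using assms equidecI[OF def_iso_refl[OF definable_enc[of As]]] by fastforce
qed

lemma equidec_sym: "M \<asymp> N \<Longrightarrow> N \<asymp> M"
  unfolding equidec_def by (auto dest: def_iso_sym)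

lemma equidec_trans [trans]:
  assumes "M \<asymp> N" "N \<asymp> P"
  shows "M \<asymp> P"
proof -
  obtain As Bs Cs where "mset As = M" "mset Bs = N" "mset Cs = P" using ex_mset by metis
  note As = this
  have "def_iso L (enc As) (enc Cs)"
    using assms unfolding As[symmetric] by (rule def_iso_trans[OF equidec_encD equidec_encD])
  moreover have "definable_subset L A" if "A \<in> set As \<union> set Cs" for A
    using that equidec_definable[OF assms(1), of A] equidec_definable[OF assms(2), of A]
    by (auto simp: As[symmetric])
  ultimately show ?thesis using equidecI As by blast
qed

lemma equidec_add:
  assumes "M \<asymp> N" "M' \<asymp> N'"
  shows "M + M' \<asymp> N + N'"
proof -
  obtain As Bs where 1: "mset As = M" "mset Bs = N" by (meson ex_mset)
  obtain As' Bs' where 2: "mset As' = M'" "mset Bs' = N'" by (meson ex_mset)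
  have d: "definable_subset L A" if "A \<in> set (As @ As') \<union> set (Bs @ Bs')" for A
    using equidec_definable[OF assms(1), of A] equidec_definable[OF assms(2), of A] that
    by (auto simp: 1[symmetric] 2[symmetric])
  have "def_iso L (enc (As @ As')) (dunion (enc As) (enc As'))"
    using d by (intro enc_append) auto
  also have "def_iso L \<dots> (dunion (enc Bs) (enc Bs'))"
    by (intro dunion_cong equidec_encD; simp only: 1 2 assms)
  also have "def_iso L \<dots> (enc (Bs @ Bs'))"
    using d by (intro def_iso_sym[OF enc_append]) auto
  finally have "mset (As @ As') \<asymp> mset (Bs @ Bs')"
    using d by (intro equidecI) auto
  then show ?thesis using 1 2 by simp
qed

lemma equidec_repeat:
  assumes "M \<asymp> N"
  shows "repeat_mset k M \<asymp> repeat_mset k N"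
proof (induction k)
  case 0
  show ?case using equidec_refl[of "{#}"] by simp
next
  case (Suc k)
  then show ?case using equidec_add[OF assms] by simp
qed

lemma equidec_single_iff: "{#A#} \<asymp> {#B#} \<longleftrightarrow> def_iso L A B"
proof -
  have 1: "def_iso L (enc [A]) A" if "definable_subset L A" for A
    using that by (simp add: dunion_single)
  show ?thesis
  proof
    assume AB: "{#A#} \<asymp> {#B#}"
    then have "def_iso L (enc [A]) (enc [B])" by (intro equidec_encD) simp
    then show "def_iso L A B"
      using def_iso_trans[OF def_iso_sym[OF 1] def_iso_trans[OF _ 1]] equidec_definable[OF AB] by simp
  next
    assume AB: "def_iso L A B"
    have "def_iso L (enc [A]) (enc [B])"
      using def_iso_trans[OF 1 def_iso_trans[OF AB def_iso_sym[OF 1]]] def_iso_definable[OF AB] .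
    then have "mset [A] \<asymp> mset [B]"
      using def_iso_definable[OF AB] by (intro equidecI) auto
    then show "{#A#} \<asymp> {#B#}" by simp
  qed
qed

lemma equidec_empty: "{#{}#} \<asymp> {#}"
proof -
  have "def_iso L (enc [{}]) (enc [])"
    by (simp add: dunion_def def_iso_refl definable_subset_empty)
  from equidecI[OF this] show ?thesis by (simp add: definable_subset_empty)
qed

lemma equidec_Un:
  assumes "definable_subset L A" "definable_subset L B" "A \<inter> B = {}"
  shows "{#A \<union> B#} \<asymp> {#A, B#}"
proof -
  have "def_iso L (enc [A \<union> B]) (A \<union> B)"
    using assms by (simp add: dunion_single definable_subset_Un)
  also have "def_iso L \<dots> (dunion A B)"
    using assms by (rule dunion_disjoint)
  also have "def_iso L \<dots> (enc [A, B])"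
    unfolding enc.simps by (intro dunion_cong def_iso_refl def_iso_sym[OF dunion_single] assms)
  finally have "mset [A \<union> B] \<asymp> mset [A, B]"
    using assms by (intro equidecI) (auto intro: definable_subset_Un)
  then show ?thesis by simp
qed

lemma equidec_UN:
  assumes "finite I" "\<And>i. i \<in> I \<Longrightarrow> def_iso L (A i) B" "disjoint_family_on A I"
  shows "{#\<Union>i\<in>I. A i#} \<asymp> replicate_mset (card I) B"
  using assms
proof (induction I rule: finite_induct)
  case empty
  then show ?case by (simp add: equidec_empty)
next
  case (insert i I)
  have d: "definable_subset L (A j)" if "j \<in> insert i I" for j
    using insert.prems(1)[OF that] by (rule def_iso_definable)
  have "A i \<inter> (\<Union>i\<in>I. A i) = {}"
    using insert.hyps insert.prems(2) by (auto simp: disjoint_family_on_def)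
  then have "{#A i \<union> (\<Union>i\<in>I. A i)#} \<asymp> {#A i, \<Union>i\<in>I. A i#}"
    using d by (intro equidec_Un definable_subset_UN insert.hyps) auto
  also have "{#A i, \<Union>i\<in>I. A i#} = {#A i#} + {#\<Union>i\<in>I. A i#}" by simp
  also have "\<dots> \<asymp> {#B#} + replicate_mset (card I) B"
    using insert.prems disjoint_family_on_mono[of I "insert i I" A]
    by (intro equidec_add insert.IH) (auto simp: equidec_single_iff)
  finally show ?case using insert.hyps by simp
qed

end

section \<open>Cosets of powers and roots of unity\<close>

text \<open>One element is chosen from each orbit of \<open>\<sigma>\<close>. The choice
  \<open>f c\<close> depends only on the set \<open>{c, \<sigma> c}\<close>, so the two elements of
  an orbit agree on it.\<close>

lemma fixpoint_free_involution_half: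
  assumes "finite C" "\<And>c. c \<in> C \<Longrightarrow> \<sigma> c \<in> C" "\<And>c. c \<in> C \<Longrightarrow> \<sigma> (\<sigma> c) = c" "\<And>c. c \<in> C \<Longrightarrow> \<sigma> c \<noteq> c"
  obtains H where "H \<subseteq> C" "C = H \<union> \<sigma> ` H" "H \<inter> \<sigma> ` H = {}" "card C = 2 * card H"
proof -
  define f where "f c = (SOME d. d \<in> {c, \<sigma> c})" for c
  have f: "f c \<in> {c, \<sigma> c}" for c
    unfolding f_def by (rule someI[of _ c]) simp
  have f_\<sigma>: "f (\<sigma> c) = f c" if "c \<in> C" for c
    using assms(3)[OF that] by (simp add: f_def insert_commute)
  define H where "H = {c \<in> C. f c = c}"
  have 1: "H \<subseteq> C" by (auto simp: H_def)
  have 2: "C = H \<union> \<sigma> ` H"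
  proof (intro equalityI subsetI)
    fix c assume c: "c \<in> C"
    show "c \<in> H \<union> \<sigma> ` H"
    proof (cases "f c = c")
      case False
      then have "\<sigma> c \<in> H" using f[of c] f_\<sigma>[OF c] assms(2)[OF c] by (auto simp: H_def)
      then show ?thesis using assms(3)[OF c] by (metis UnI2 imageI)
    qed (use c in \<open>auto simp: H_def\<close>)
  qed (use assms(2) in \<open>auto simp: H_def\<close>)
  have 3: "H \<inter> \<sigma> ` H = {}"
  proof -
    have False if "c \<in> C" "f c = c" "f (\<sigma> c) = \<sigma> c" for c
      using that f_\<sigma>[of c] assms(4)[of c] by simp
    then show ?thesis by (auto simp: H_def)
  qed
  have "inj_on \<sigma> H" using assms(3) 1 by (metis inj_onI subsetD)
  then have "card (\<sigma> ` H) = card H" by (rule card_image)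
  moreover have "finite H" using 1 assms(1) by (rule finite_subset)
  ultimately have "card C = 2 * card H" using 2 3 card_Un_disjoint[of H "\<sigma> ` H"] by simp
  with 1 2 3 show ?thesis by (rule that)
qed

section \<open>Cosets of the subgroup of n-th powers\<close>

lemma nth_powersI: "x \<noteq> 0 \<Longrightarrow> x ^ n \<in> nth_powers n"
  by (auto simp: nth_powers_def)

lemma nth_powers_nonzero: "x \<in> nth_powers n \<Longrightarrow> x \<noteq> (0 :: 'a::field)"
  by (auto simp: nth_powers_def)

lemma nth_powers_mult:
  assumes "x \<in> nth_powers n" "y \<in> nth_powers n"
  shows "x * y \<in> (nth_powers n :: 'a::field set)"
proof -
  obtain a b where "x = a ^ n" "y = b ^ n" "a \<noteq> 0" "b \<noteq> 0" using assms by (auto simp: nth_powers_def)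
  then show ?thesis using nth_powersI[of "a * b" n] by (simp add: power_mult_distrib)
qed

lemma nth_powers_divide:
  assumes "x \<in> nth_powers n" "y \<in> nth_powers n"
  shows "x / y \<in> (nth_powers n :: 'a::field set)"
proof -
  obtain a b where "x = a ^ n" "y = b ^ n" "a \<noteq> 0" "b \<noteq> 0" using assms by (auto simp: nth_powers_def)
  then show ?thesis using nth_powersI[of "a / b" n] by (simp add: power_divide)
qed

lemma one_in_nth_powers: "1 \<in> (nth_powers n :: 'a::field set)"
  using nth_powersI[of 1 n] by simp

definition power_transversal :: "nat \<Rightarrow> 'a::field set \<Rightarrow> bool" where
  "power_transversal n C \<longleftrightarrow> 0 \<notin> C \<and> (\<forall>x. x \<noteq> 0 \<longrightarrow> (\<exists>!c. c \<in> C \<and> x / c \<in> nth_powers n))"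

lemma power_cosets_eq:
  "power_cosets n = (\<lambda>a. (\<lambda>h. h * a) ` nth_powers n) ` (UNIV - {0 :: 'a::field})"
  by (auto simp: power_cosets_def RCOSETS_def r_coset_def ring_of_type_algebra_def)

lemma power_coset_eq_iff:
  assumes "a \<noteq> 0" "b \<noteq> (0 :: 'a::field)"
  shows "(\<lambda>h. h * a) ` nth_powers n = (\<lambda>h. h * b) ` nth_powers n \<longleftrightarrow> a / b \<in> nth_powers n"
proof
  assume "(\<lambda>h. h * a) ` nth_powers n = (\<lambda>h. h * b) ` nth_powers n"
  moreover have "a \<in> (\<lambda>h. h * a) ` nth_powers n" using one_in_nth_powers by force
  ultimately obtain h where "h \<in> nth_powers n" "a = h * b" by auto
  then show "a / b \<in> nth_powers n" using assms by simp
next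
  have *: "(\<lambda>h. h * a) ` nth_powers n \<subseteq> (\<lambda>h. h * b) ` nth_powers n"
    if "a / b \<in> nth_powers n" "b \<noteq> 0" for a b :: 'a
  proof
    fix x assume "x \<in> (\<lambda>h. h * a) ` nth_powers n"
    then obtain h where h: "h \<in> nth_powers n" "x = h * a" by auto
    then have "x = (h * (a / b)) * b" using that by simp
    then show "x \<in> (\<lambda>h. h * b) ` nth_powers n" using nth_powers_mult[OF h(1) that(1)] by blast
  qed
  assume ab: "a / b \<in> nth_powers n"
  then have "b / a \<in> nth_powers n"
    using nth_powers_divide[OF one_in_nth_powers ab] by simp
  then show "(\<lambda>h. h * a) ` nth_powers n = (\<lambda>h. h * b) ` nth_powers n"
    using *[OF ab] *[of b a] assms by auto
qed

text \<open>One element is chosen from each fibre of the map to cosets; the resulting bijection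
  makes the size of \<open>C\<close> the index when this is finite.\<close>

lemma power_transversal_exists:
  obtains C :: "'a::field set" where "power_transversal n C"
    "bij_betw (\<lambda>a. (\<lambda>h. h * a) ` nth_powers n) C (power_cosets n)"
proof -
  define g where "g a = (\<lambda>h. h * a) ` nth_powers n" for a :: 'a
  have g_eq: "g a = g b \<longleftrightarrow> a / b \<in> nth_powers n" if "a \<noteq> 0" "b \<noteq> 0" for a b
    unfolding g_def using that by (rule power_coset_eq_iff)
  obtain C where C: "C \<subseteq> UNIV - {0}" "inj_on g C" "g ` (UNIV - {0}) = g ` C"
    using iffD1[OF subset_image_inj, OF subset_refl[of "g ` (UNIV - {0})"]] by (elim exE conjE)
  have C0: "c \<noteq> 0" if "c \<in> C" for c using C(1) that by blast
  have "power_transversal n C"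
    unfolding power_transversal_def
  proof (intro conjI allI impI)
    show "0 \<notin> C" using C0 by blast
    fix x :: 'a assume x: "x \<noteq> 0"
    then have "g x \<in> g ` C" unfolding C(3)[symmetric] by blast
    then obtain c where c: "c \<in> C" "g x = g c" by blast
    show "\<exists>!c. c \<in> C \<and> x / c \<in> nth_powers n"
    proof (intro ex1I[of _ c] conjI c)
      show "x / c \<in> nth_powers n" using c g_eq[OF x C0[OF c(1)]] by simp
      fix d assume d: "d \<in> C \<and> x / d \<in> nth_powers n"
      then have "g d = g c" using g_eq[OF x C0[of d]] c(2) by simp
      then show "d = c" using c(1) d by (intro inj_onD[OF C(2)]) simp_all
    qed
  qed
  moreover have "g ` C = power_cosets n"
    unfolding C(3)[symmetric] power_cosets_eq g_def ..
  with C(2) have "bij_betw g C (power_cosets n)" unfolding bij_betw_def ..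
  ultimately show ?thesis unfolding g_def by (rule that)
qed

lemma power_transversal_unique:
  assumes "power_transversal n C" "c \<in> C" "d \<in> C" "x / c \<in> nth_powers n" "x / d \<in> nth_powers n"
  shows "c = (d :: 'a::field)"
proof -
  have "x \<noteq> 0" using nth_powers_nonzero[OF assms(4)] by auto
  then show ?thesis using assms unfolding power_transversal_def by blast
qed

lemma power_transversal_rep:
  assumes "power_transversal n (C :: 'a::field set)"
  obtains \<rho> where "\<And>x. x \<noteq> 0 \<Longrightarrow> \<rho> x \<in> C" "\<And>x. x \<noteq> 0 \<Longrightarrow> x / \<rho> x \<in> nth_powers n"
    "\<And>x c. c \<in> C \<Longrightarrow> x / c \<in> nth_powers n \<Longrightarrow> \<rho> x = c"
proof -
  have "\<forall>x\<in>UNIV - {0}. \<exists>c. c \<in> C \<and> x / c \<in> nth_powers n"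
    using assms unfolding power_transversal_def by blast
  then obtain \<rho> where "\<forall>x\<in>UNIV - {0}. \<rho> x \<in> C \<and> x / \<rho> x \<in> nth_powers n"
    unfolding bchoice_iff by (elim exE)
  then have \<rho>: "\<rho> x \<in> C" "x / \<rho> x \<in> nth_powers n" if "x \<noteq> 0" for x
    using that by simp_all
  have \<rho>_eq: "\<rho> x = c" if "c \<in> C" "x / c \<in> nth_powers n" for x c
  proof -
    have "x \<noteq> 0" using nth_powers_nonzero[OF that(2)] by auto
    from power_transversal_unique[OF assms \<rho>(1)[OF this] that(1) \<rho>(2)[OF this] that(2)]
    show ?thesis .
  qed
  with \<rho> show ?thesis by (rule that)
qed

text \<open>Inversion is an involution of \<open>K\<^sup>\<times> / P\<^sub>n\<close>. This group is
  killed by the odd number \<open>n\<close>, so only the trivial class is fixed and all other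
  classes fall into pairs. On representatives, inversion is \<open>\<sigma>\<close> and the trivial
  class is \<open>\<rho> 1\<close>.\<close>

lemma odd_power_index:
  assumes "power_transversal n (C :: 'a::field set)" "finite C" "odd n"
  shows "odd (card C)"
proof -
  have C0: "c \<noteq> 0" if "c \<in> C" for c using assms(1) that by (auto simp: power_transversal_def)
  obtain \<rho> :: "'a \<Rightarrow> 'a" where \<rho>: "\<And>x. x \<noteq> 0 \<Longrightarrow> \<rho> x \<in> C" "\<And>x. x \<noteq> 0 \<Longrightarrow> x / \<rho> x \<in> nth_powers n"
    and \<rho>_eq: "\<And>x c. c \<in> C \<Longrightarrow> x / c \<in> nth_powers n \<Longrightarrow> \<rho> x = c"
    using assms(1) by (rule power_transversal_rep) blast
  define \<sigma> where "\<sigma> c = \<rho> (1 / c)" for c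
  have inv: "\<sigma> (\<sigma> c) = c" if "c \<in> C" for c
  proof -
    have "1 / c / \<sigma> c \<in> nth_powers n" unfolding \<sigma>_def by (rule \<rho>(2)) (use C0[OF that] in simp)
    then have "1 / \<sigma> c / c \<in> nth_powers n" by (simp add: mult.commute)
    then show ?thesis unfolding \<sigma>_def[of "\<sigma> c"] by (rule \<rho>_eq[OF that])
  qed
  have mem: "\<sigma> c \<in> C" if "c \<in> C" for c
    unfolding \<sigma>_def by (rule \<rho>(1)) (use C0[OF that] in simp)
  have fixed: "c = \<rho> 1" if c: "c \<in> C" "\<sigma> c = c" for c
  proof -
    have "1 / c / c \<in> nth_powers n"
      using \<rho>(2)[of "1 / c"] C0[OF c(1)] c(2) by (simp add: \<sigma>_def)
    then obtain y where y: "y \<noteq> 0" "1 / c / c = y ^ n" by (auto simp: nth_powers_def)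
    obtain m where m: "n = 2 * m + 1" using assms(3) by (elim oddE)
    \<comment> \<open>With \<open>n = 2 * m + 1\<close> the inverse of \<open>c\<close> is a power
      of its inverse square times \<open>c ^ n\<close>. Both factors are n-th powers, so
      \<open>c\<close> lies in the trivial class.\<close>
    have "1 / c = (1 / c / c) ^ (m + 1) * c ^ n"
      using C0[OF c(1)] by (simp add: m power_divide mult_2 power_add power_mult_distrib)
    also have "\<dots> = (y ^ (m + 1) * c) ^ n"
      unfolding y(2) by (simp only: power_mult_distrib power_mult[symmetric] mult.commute[of n])
    also have "\<dots> \<in> nth_powers n" using y C0[OF c(1)] by (intro nth_powersI) auto
    finally show ?thesis using \<rho>_eq[OF c(1)] by blast
  qed
  have fix1: "\<sigma> (\<rho> 1) = \<rho> 1"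
  proof -
    have "1 / \<rho> 1 \<in> nth_powers n" using \<rho>(2)[of 1] by simp
    from nth_powers_mult[OF this this] have "1 / \<rho> 1 / \<rho> 1 \<in> nth_powers n" by simp
    then show ?thesis unfolding \<sigma>_def by (rule \<rho>_eq[OF \<rho>(1)[OF one_neq_zero]])
  qed
  obtain H where "H \<subseteq> C - {\<rho> 1}" "C - {\<rho> 1} = H \<union> \<sigma> ` H" "H \<inter> \<sigma> ` H = {}"
    "card (C - {\<rho> 1}) = 2 * card H"
  proof (rule fixpoint_free_involution_half[of "C - {\<rho> 1}" \<sigma>])
    show "finite (C - {\<rho> 1})" using assms(2) by simp
    show "\<sigma> c \<in> C - {\<rho> 1}" if c: "c \<in> C - {\<rho> 1}" for c
    proof -
      have "\<sigma> c \<noteq> \<rho> 1"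
      proof
        assume "\<sigma> c = \<rho> 1"
        then have "c = \<rho> 1" using inv[of c] fix1 c by simp
        then show False using c by simp
      qed
      then show ?thesis using mem c by simp
    qed
    show "\<sigma> (\<sigma> c) = c" if "c \<in> C - {\<rho> 1}" for c using that inv[of c] by blast
    show "\<sigma> c \<noteq> c" if "c \<in> C - {\<rho> 1}" for c using that fixed[of c] by blast
  qed (rule that)
  moreover have "card C = Suc (card (C - {\<rho> 1}))"
    by (rule card.remove[OF assms(2) \<rho>(1)[OF one_neq_zero]])
  ultimately show ?thesis by simp
qed

text \<open>In characteristic 2 the elements \<open>1 + \<pi> y\<^sup>2\<close> represent pairwise different classes modulo
  squares, provided \<open>\<pi>\<close> is not a square.\<close>

lemma infinite_even_power_index_char2:
  fixes \<pi> :: "'a::field"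
  assumes "2 = (0 :: 'a)" "infinite (UNIV :: 'a set)" "\<And>x. x ^ 2 \<noteq> \<pi>" "even n"
  shows "infinite (power_cosets n :: 'a set set)"
proof
  assume fin: "finite (power_cosets n :: 'a set set)"
  have minus: "- x = x" for x :: 'a
    using mult_2[of x] assms(1) by (simp add: minus_unique)
  let ?u = "\<lambda>y. 1 + \<pi> * y ^ 2"
  have u0: "?u y \<noteq> 0" for y
  proof
    assume "?u y = 0"
    then have "\<pi> * y ^ 2 = 1" using add_eq_0_iff2[of 1 "\<pi> * y ^ 2"] minus[of "\<pi> * y ^ 2"] by simp
    moreover from this have "y \<noteq> 0" by auto
    ultimately have "(1 / y) ^ 2 = \<pi>" by (simp add: power_divide divide_eq_eq)
    then show False using assms(3) by blast
  qed
  let ?g = "\<lambda>a::'a. (\<lambda>h. h * a) ` nth_powers n"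
  have "inj (\<lambda>y. ?g (?u y))"
  proof (rule injI, rule ccontr)
    fix y z assume "?g (?u y) = ?g (?u z)" and yz: "y \<noteq> z"
    then have "?u y / ?u z \<in> nth_powers n" using power_coset_eq_iff[OF u0 u0] by simp
    then obtain x where x: "?u y / ?u z = x ^ n" by (auto simp: nth_powers_def)
    \<comment> \<open>As \<open>n\<close> is even, the quotient is a square, and so is the product
      of the two elements. In characteristic 2 this product equals
      \<open>A ^ 2 + \<pi> * (y + z) ^ 2\<close>. Hence \<open>\<pi> * (y + z) ^ 2\<close> is a sum
      of two squares, which is again a square, and \<open>\<pi>\<close> would be one too.\<close>
    obtain m where m: "n = m * 2" using assms(4) by (elim evenE) (simp add: mult.commute)
    define w where "w = x ^ m * ?u z"
    define A where "A = 1 + \<pi> * y * z"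
    have "?u y * ?u z = (?u y / ?u z) * ?u z ^ 2"
      using u0[of z] by (simp add: power2_eq_square)
    also have "\<dots> = w ^ 2"
      unfolding x m w_def by (simp only: power_mult power_mult_distrib)
    also have "?u y * ?u z = A ^ 2 + \<pi> * (y + z) ^ 2 - 2 * (2 * \<pi> * y * z)"
      unfolding A_def by (simp add: power2_eq_square algebra_simps)
    finally have "\<pi> * (y + z) ^ 2 = w ^ 2 - A ^ 2" using assms(1) by (simp add: algebra_simps)
    also have "\<dots> = (w - A) ^ 2 + 2 * (w * A - A ^ 2)"
      by (simp add: power2_eq_square algebra_simps)
    finally have eq: "\<pi> * (y + z) ^ 2 = (w - A) ^ 2" using assms(1) by simp
    have "y + z \<noteq> 0" using yz unfolding add_eq_0_iff2[of y z] minus .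
    then have "((w - A) / (y + z)) ^ 2 = \<pi>"
      by (simp add: power_divide eq[symmetric])
    then show False using assms(3) by blast
  qed
  moreover have "range (\<lambda>y. ?g (?u y)) \<subseteq> power_cosets n"
    unfolding power_cosets_eq using u0 by auto
  ultimately show False
    using fin assms(2) by (meson finite_imageD finite_subset)
qed

lemma finite_roots_of_unity:
  assumes "n > 0"
  shows "finite {x :: 'a::field. x ^ n = 1}"
proof -
  let ?p = "monom 1 n - 1 :: 'a poly"
  have "coeff ?p n = 1" using assms by simp
  then have "?p \<noteq> 0" by (metis coeff_0 zero_neq_one)
  then have "finite {x. poly ?p x = 0}" by (rule poly_roots_finite)
  then show ?thesis by (simp add: poly_monom)
qed

section \<open>Tilings and root functions\<close>

text \<open>The common form of two decompositions of \<open>K\<^sup>\<times>\<close>: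
  \<open>T\<close> represents the classes modulo n-th powers and \<open>D\<close> is the set of n-th
  powers, or \<open>T\<close> is the set of n-th roots of unity and \<open>D\<close> the range of a
  root function.\<close>

definition tiles :: "'a::field set \<Rightarrow> 'a set \<Rightarrow> 'a set \<Rightarrow> bool" where
  "tiles T D A \<longleftrightarrow> finite T \<and> 0 \<notin> T \<and> A = (\<Union>t\<in>T. (*) t ` D) \<and> disjoint_family_on (\<lambda>t. (*) t ` D) T"

lemma def_iso_scale:
  assumes "definable_subset L D" "c \<noteq> 0"
  shows "def_iso L D ((*) c ` D)"
  by (rule def_isoI[of _ "(*) c" D])
     (use assms in \<open>auto intro!: definable_fun_trm definable_intros inj_onI\<close>)

lemma definable_subset_scale:
  assumes "definable_subset L D" "c \<noteq> 0"
  shows "definable_subset L ((*) c ` D)"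
  using def_iso_scale[OF assms] by (rule def_iso_definable)

lemma tiles_definable: "tiles T D A \<Longrightarrow> definable_subset L D \<Longrightarrow> definable_subset L A"
  unfolding tiles_def by (auto intro!: definable_subset_UN definable_subset_scale)

lemma (in line_doubling) equidec_tiles:
  assumes "tiles T D A" "definable_subset L D"
  shows "{#A#} \<asymp> replicate_mset (card T) D"
proof -
  have "def_iso L ((*) t ` D) D" if "t \<in> T" for t
    using that assms by (intro def_iso_sym[OF def_iso_scale]) (auto simp: tiles_def)
  then show ?thesis using assms(1) equidec_UN[of T "\<lambda>t. (*) t ` D" D] by (auto simp: tiles_def)
qed

lemma tiles_powers:
  assumes "power_transversal n C" "finite C"
  shows "tiles C (nth_powers n) (UNIV - {0 :: 'a::field})"
  unfolding tiles_def
proof (intro conjI)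
  show "0 \<notin> C" using assms(1) by (simp add: power_transversal_def)
  then have C0: "c \<noteq> 0" if "c \<in> C" for c using that by auto
  show "UNIV - {0} = (\<Union>c\<in>C. (*) c ` nth_powers n)"
  proof (intro equalityI subsetI)
    fix x :: 'a assume "x \<in> UNIV - {0}"
    then obtain c where "c \<in> C" "x / c \<in> nth_powers n"
      using assms(1) unfolding power_transversal_def by blast
    moreover have "x = c * (x / c)" using C0[of c] \<open>c \<in> C\<close> by simp
    ultimately show "x \<in> (\<Union>c\<in>C. (*) c ` nth_powers n)" by blast
  qed (auto dest: C0 nth_powers_nonzero)
  show "disjoint_family_on (\<lambda>c. (*) c ` nth_powers n) C"
    unfolding disjoint_family_on_def
  proof (intro ballI impI equals0I)
    fix c d x assume *: "c \<in> C" "d \<in> C" "c \<noteq> d" "x \<in> (*) c ` nth_powers n \<inter> (*) d ` nth_powers n"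
    then obtain a b where "x = c * a" "x = d * b" "a \<in> nth_powers n" "b \<in> nth_powers n" by blast
    then have "x / c \<in> nth_powers n" "x / d \<in> nth_powers n"
      using C0[OF *(1)] C0[OF *(2)] nonzero_mult_div_cancel_left by metis+
    then show False using power_transversal_unique[OF assms(1) *(1,2)] *(3) by blast
  qed
qed (rule assms)

text \<open>A nonzero \<open>y\<close> and the chosen root of \<open>y ^ n\<close> differ by a root
  of unity. The tiles are disjoint because multiplying an element of \<open>S\<close> by a root of
  unity preserves its n-th power, and this power determines the element.\<close>

lemma definable_root_transversal:
  assumes "has_definable_root (L :: ('f, 'r, 'a::field) ring_expansion) n" "n > 0"
  obtains S where "def_iso L (nth_powers n) S" "tiles {x. x ^ n = 1} S (UNIV - {0})"
proof -
  obtain S f where S: "S \<subseteq> UNIV - {0}" "bij_betw f (nth_powers n) S"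
    and d: "definable L 2 {[x, f x] | x. x \<in> nth_powers n}"
    and f: "\<And>x. x \<in> nth_powers n \<Longrightarrow> f x ^ n = x"
    and S_def: "definable L 1 (pts S)"
    using assms(1) unfolding has_definable_root_def by blast
  have df: "definable_fun L f (nth_powers n)" using d by (rule definable_graph_imp_definable_fun)
  have dP: "definable_subset L (nth_powers n :: 'a set)"
  proof -
    have eq: "e 0 \<in> nth_powers n \<longleftrightarrow> (\<exists>x. e 0 = x ^ n \<and> \<not> x = 0)" for e :: "nat \<Rightarrow> 'a"
      by (auto simp: nth_powers_def)
    show ?thesis unfolding definable_subset_def eq
      by (intro definable_pred_ex definable_pred_conj definable_pred_not definable_pred_eq
          definable_trm_power definable_trm_var definable_trm_const)
  qed
  have "def_iso L (nth_powers n) S"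
    by (rule def_isoI[OF df subset_refl dP]) (use S(2) in \<open>auto simp: bij_betw_def\<close>)
  moreover have "tiles {x. x ^ n = 1} S (UNIV - {0})"
    unfolding tiles_def
  proof (intro conjI)
    show "finite {x::'a. x ^ n = 1}" using assms(2) by (rule finite_roots_of_unity)
    show z: "0 \<notin> {x::'a. x ^ n = 1}" using assms(2) by (simp add: power_0_left)
    show "UNIV - {0} = (\<Union>t\<in>{x. x ^ n = 1}. (*) t ` S)"
    proof (intro equalityI subsetI)
      fix y :: 'a assume y: "y \<in> UNIV - {0}"
      define s where "s = f (y ^ n)"
      have s: "s \<in> S" "s ^ n = y ^ n" "s \<noteq> 0"
        using y nth_powersI[of y n] f[of "y ^ n"] S by (auto simp: s_def bij_betw_def)
      then have "(y / s) ^ n = 1" "y = y / s * s" using y by (auto simp: power_divide)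
      then show "y \<in> (\<Union>t\<in>{x. x ^ n = 1}. (*) t ` S)" using s(1) by blast
    qed (use S(1) z in auto)
    have uniq: "s = s'" if "s \<in> S" "s' \<in> S" "s ^ n = s' ^ n" for s s'
      using that S(2) f by (auto simp: bij_betw_def)
    show "disjoint_family_on (\<lambda>t. (*) t ` S) {x. x ^ n = 1}"
      unfolding disjoint_family_on_def
    proof (intro ballI impI equals0I)
      fix t u x assume *: "t \<in> {x. x ^ n = 1}" "u \<in> {x. x ^ n = 1}" "t \<noteq> u" "x \<in> (*) t ` S \<inter> (*) u ` S"
      then obtain s s' where s: "s \<in> S" "s' \<in> S" "x = t * s" "x = u * s'" by auto
      have "x ^ n = s ^ n" unfolding s(3) using *(1) by (simp add: power_mult_distrib)
      moreover have "x ^ n = s' ^ n" unfolding s(4) using *(2) by (simp add: power_mult_distrib)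
      ultimately have "s = s'" using uniq[OF s(1,2)] by simp
      moreover have "s \<noteq> 0" using s(1) S(1) by blast
      ultimately show False using s(3,4) *(3) by simp
    qed
  qed
  ultimately show ?thesis by (rule that)
qed

context line_doubling
begin

lemma repeat_replicate_mset: "repeat_mset k (replicate_mset m a) = replicate_mset (k * m) a"
  by (rule multiset_eqI) simp

lemma equidec_replicate:
  assumes "{#A#} \<asymp> M"
  shows "replicate_mset k A \<asymp> repeat_mset k M"
  using equidec_repeat[OF assms, of k] repeat_replicate_mset[of k 1 A] by simp

lemma equidec_replicate_iso:
  assumes "def_iso L A B"
  shows "replicate_mset k A \<asymp> replicate_mset k B"
  using equidec_replicate[of A "{#B#}" k] assms repeat_replicate_mset[of k 1 B]
  by (simp add: equidec_single_iff)

section \<open>Self-similarity of the multiplicative group\<close>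

lemma root_data:
  assumes "has_definable_root L n" "n > 0" "finite (power_cosets n :: 'a set set)"
  obtains C :: "'a set" and S where "power_transversal n C" "finite C" "card C = card (power_cosets n :: 'a set set)"
    "def_iso L (nth_powers n) S" "tiles {x. x ^ n = 1} S (UNIV - {0})"
proof -
  obtain C :: "'a set" where C: "power_transversal n C"
    "bij_betw (\<lambda>a. (\<lambda>h. h * a) ` nth_powers n) C (power_cosets n)"
    by (rule power_transversal_exists)
  obtain S where S: "def_iso L (nth_powers n) S" "tiles {x. x ^ n = 1} S (UNIV - {0})"
    using assms(1,2) by (rule definable_root_transversal)
  show ?thesis
    by (rule that[OF C(1) _ _ S]) (use bij_betw_finite[OF C(2)] bij_betw_same_card[OF C(2)] assms(3) in auto)
qed

text \<open>Let s be the index, r the number of roots of unity and S the range of the root function.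
  Then \<open>K\<^sup>\<times>\<close> consists of s copies of \<open>P\<^sub>n\<close>, hence of s
  = l r copies of S, and every r of these reassemble to one \<open>K\<^sup>\<times>\<close>.\<close>

lemma units_equidec_index_quotient:
  assumes "has_definable_root L n" "n > 0" "finite (power_cosets n :: 'a set set)"
    and "card (power_cosets n :: 'a set set) = l * num_roots_of_unity TYPE('a) n"
  shows "{#UNIV - {0}#} \<asymp> replicate_mset l (UNIV - {0})"
proof -
  obtain C :: "'a set" and S where C: "power_transversal n C" "finite C" "card C = card (power_cosets n :: 'a set set)"
    and S: "def_iso L (nth_powers n) S" "tiles {x. x ^ n = 1} S (UNIV - {0})"
    using assms(1-3) by (rule root_data)
  have "{#UNIV - {0}#} \<asymp> replicate_mset (card C) (nth_powers n)"
    using tiles_powers[OF C(1,2)] def_iso_definable(1)[OF S(1)] by (rule equidec_tiles)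
  also have "\<dots> \<asymp> replicate_mset (card C) S"
    using S(1) by (rule equidec_replicate_iso)
  also have "\<dots> = repeat_mset l (replicate_mset (num_roots_of_unity TYPE('a) n) S)"
    by (simp add: repeat_replicate_mset C(3) assms(4))
  also have "\<dots> \<asymp> replicate_mset l (UNIV - {0})"
    unfolding num_roots_of_unity_def
    by (intro equidec_sym[OF equidec_replicate] equidec_tiles[OF S(2)] def_iso_definable(2)[OF S(1)])
  finally show ?thesis .
qed

text \<open>The set of cosets is nonempty, so a finite index is positive and neither of its factors
  vanishes in the second case.\<close>

lemma lambda_num_cases:
  assumes "n > 1"
  obtains "lambda_num L n = 1"
  | l where "lambda_num L n = int l" "l > 0" "has_definable_root L n" "finite (power_cosets n :: 'a set set)"
    "card (power_cosets n :: 'a set set) = l * num_roots_of_unity TYPE('a) n"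
proof (cases "finite (power_cosets n :: 'a set set) \<and>
    num_roots_of_unity TYPE('a) n dvd card (power_cosets n :: 'a set set) \<and> has_definable_root L n")
  case False
  then show ?thesis using that(1) by (auto simp: lambda_num_def Let_def)
next
  case True
  define l where "l = card (power_cosets n :: 'a set set) div num_roots_of_unity TYPE('a) n"
  have l: "card (power_cosets n :: 'a set set) = l * num_roots_of_unity TYPE('a) n"
    using True by (simp add: l_def)
  have "power_cosets n \<noteq> ({} :: 'a set set)"
    unfolding power_cosets_eq using one_neq_zero by blast
  then have "card (power_cosets n :: 'a set set) > 0" using True by (simp add: card_gt_0_iff)
  then have "l > 0" "num_roots_of_unity TYPE('a) n > 0" unfolding l by simp_all
  moreover have "lambda_num L n = int l"
    using True by (simp add: lambda_num_def Let_def l_def)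
  ultimately show ?thesis using that(2)[of l] True l by blast
qed

text \<open>The generators of H are never negative, so each one is a number \<open>d\<close> of
  additional copies that one copy of \<open>K\<^sup>\<times>\<close> can produce.\<close>

lemma units_equidec_lambda:
  assumes "n > 1"
  obtains d where "lambda_num L n - 1 = int d" "{#UNIV - {0}#} \<asymp> replicate_mset (Suc d) (UNIV - {0})"
  using assms
proof (cases rule: lambda_num_cases)
  case 1
  have "{#UNIV - {0}#} \<asymp> {#UNIV - {0}#}"
    by (rule equidec_refl) (simp add: definable_subset_Diff definable_subset_UNIV definable_subset_singleton)
  then show ?thesis using that[of 0] 1 by simp
next
  case (2 l)
  then have "{#UNIV - {0}#} \<asymp> replicate_mset l (UNIV - {0})"
    using assms by (intro units_equidec_index_quotient) auto
  then show ?thesis using that[of "l - 1"] 2(1,2) by (simp add: of_nat_diff)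
qed

lemma units_equidec_double:
  assumes "H_group L = UNIV"
  shows "{#UNIV - {0}#} \<asymp> {#UNIV - {0}, UNIV - {0}#}"
proof -
  define A where "A = UNIV - {0 :: 'a}"
  have refl: "replicate_mset k A \<asymp> replicate_mset k A" for k
    by (rule equidec_refl)
      (simp split: if_splits add: A_def definable_subset_Diff definable_subset_UNIV definable_subset_singleton)
  \<comment> \<open>\<open>D\<close> collects the numbers of additional copies that one copy of
    \<open>A\<close> can produce. It is closed under addition and contains 0 and the generators of
    H, so every element of H is a difference of two members of \<open>D\<close>.\<close>
  define D where "D = {d. {#A#} \<asymp> replicate_mset (Suc d) A}"
  have add: "a + b \<in> D" if "a \<in> D" "b \<in> D" for a b
  proof -
    have "{#A#} \<asymp> {#A#} + replicate_mset a A" using that(1) by (simp add: D_def)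
    also have "\<dots> \<asymp> replicate_mset (Suc b) A + replicate_mset a A"
      using that(2) by (intro equidec_add refl) (simp add: D_def)
    also have "\<dots> = replicate_mset (Suc (a + b)) A" by (rule multiset_eqI) simp
    finally show ?thesis by (simp add: D_def)
  qed
  have "\<exists>a b. a \<in> D \<and> b \<in> D \<and> z = int a - int b" if "z \<in> H_group L" for z
    using that unfolding H_group_def
  proof (induction rule: group_closure.induct)
    case (base z)
    have 0: "0 \<in> D" using refl[of 1] by (simp add: D_def)
    consider "z = 0" | n where "n > 1" "z = lambda_num L n - 1" using base by blast
    then show ?case
    proof cases
      case 1
      then show ?thesis using 0 by (intro exI[of _ 0]) simp
    next
      case (2 n)
      obtain d where "lambda_num L n - 1 = int d" "d \<in> D"
        using units_equidec_lambda[OF 2(1)] unfolding D_def A_def by blast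
      then show ?thesis using 0 2(2) by (intro exI[of _ d] exI[of _ 0]) simp
    qed
  next
    case (diff s t)
    then obtain a b c d where "a \<in> D" "b \<in> D" "c \<in> D" "d \<in> D" "s = int a - int b" "t = int c - int d"
      by blast
    then show ?case using add[of a d] add[of b c] by (intro exI[of _ "a + d"] exI[of _ "b + c"]) simp
  qed
  from this[of 1] obtain a b where ab: "a \<in> D" "b \<in> D" "int 1 = int a - int b" using assms by auto
  then have a: "a = Suc b" by simp
  \<comment> \<open>Since \<open>a = Suc b\<close>, one copy first grows to \<open>b + 2\<close>
    copies, and then \<open>b + 1\<close> of them are put together to one, which leaves two.\<close>
  have "{#A#} \<asymp> replicate_mset (Suc b) A + {#A#}" using ab(1) by (simp add: D_def a)
  also have "\<dots> \<asymp> {#A#} + {#A#}"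
    using ab(2) refl[of 1] by (intro equidec_add) (simp_all add: D_def equidec_sym)
  finally show ?thesis by (simp add: A_def)
qed

end

section \<open>Representatives up to sign\<close>

definition sign_system :: "'a::field set \<Rightarrow> 'a set \<Rightarrow> bool" where
  "sign_system V A \<longleftrightarrow> V \<union> uminus ` V = A \<and> V \<inter> uminus ` V = {}"

lemma sign_system_minus: "sign_system V A \<Longrightarrow> x \<in> A \<Longrightarrow> x \<notin> V \<Longrightarrow> - x \<in> V"
  unfolding sign_system_def by auto

lemma sign_system_neg: "sign_system V A \<Longrightarrow> x \<in> V \<Longrightarrow> - x \<notin> V"
  unfolding sign_system_def by (metis add.inverse_inverse disjoint_iff image_eqI)

lemma sign_systemI:
  assumes "\<And>x. x \<in> A \<Longrightarrow> - x \<in> A" "V \<subseteq> A" "\<And>x. x \<in> A \<Longrightarrow> x \<notin> V \<Longrightarrow> - x \<in> V" "\<And>x. x \<in> V \<Longrightarrow> - x \<notin> V"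
  shows "sign_system V A"
  unfolding sign_system_def
proof
  show "V \<union> uminus ` V = A"
  proof (intro equalityI subsetI)
    fix x assume "x \<in> A"
    then show "x \<in> V \<union> uminus ` V" using assms(3)[of x] image_eqI[of x uminus "- x" V] by auto
  qed (use assms(1,2) in auto)
  show "V \<inter> uminus ` V = {}" using assms(4) by auto
qed

text \<open>For \<open>x\<close> in \<open>V\<close> exactly one of \<open>x\<close> and
  \<open>- x\<close> lies in \<open>V'\<close>. Sending \<open>x\<close> to it is injective because
  \<open>V\<close> contains no two opposite elements.\<close>

lemma sign_system_iso:
  assumes "sign_system V A" "sign_system V' A" "definable_subset L V" "definable_subset L V'"
  shows "def_iso L V (V' :: 'a::field set)"
proof -
  define f where "f x = (if x \<in> V' then x else - x)" for x
  have "V \<subseteq> A" "V' \<subseteq> A" using assms(1,2) by (auto simp: sign_system_def)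
  have eq: "(e 0 \<in> V \<and> e 1 = f (e 0)) =
      (e 0 \<in> V \<and> (e 0 \<in> V' \<and> e 1 = e 0 \<or> \<not> e 0 \<in> V' \<and> e 1 = - e 0))" for e :: "nat \<Rightarrow> 'a"
    by (auto simp: f_def)
  have "definable_fun L f V"
    unfolding definable_fun_def eq
    by (intro definable_pred_conj definable_pred_disj definable_pred_not definable_pred_mem
        definable_pred_eq definable_trm_uminus definable_trm_var assms)
  moreover have "inj_on f V"
  proof (rule inj_onI)
    fix x y assume "x \<in> V" "y \<in> V" "f x = f y"
    then show "x = y"
      using sign_system_neg[OF assms(1), of x] sign_system_neg[OF assms(1), of y]
      by (auto simp: f_def split: if_splits)
  qed
  moreover have "f ` V = V'"
  proof (intro equalityI subsetI)
    fix y assume "y \<in> f ` V"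
    then show "y \<in> V'"
      using sign_system_minus[OF assms(2)] \<open>V \<subseteq> A\<close> by (auto simp: f_def split: if_splits)
  next
    fix y assume y: "y \<in> V'"
    show "y \<in> f ` V"
    proof (cases "y \<in> V")
      case True
      then show ?thesis using y by (intro image_eqI[of _ _ y]) (simp_all add: f_def)
    next
      case False
      then have "- y \<in> V" using sign_system_minus[OF assms(1), of y] y \<open>V' \<subseteq> A\<close> by blast
      moreover have "- y \<notin> V'" using sign_system_neg[OF assms(2) y] .
      ultimately show ?thesis by (intro image_eqI[of _ _ "- y"]) (simp_all add: f_def)
    qed
  qed
  ultimately show ?thesis by (intro def_isoI[OF _ subset_refl assms(3)])
qed

text \<open>The tile of \<open>- h\<close> is the negative of the tile of \<open>h\<close>, so half
  of the scalars already covers \<open>A\<close> up to sign.\<close>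

lemma tiles_sign_system:
  assumes "tiles (H \<union> uminus ` H) D A" "H \<inter> uminus ` H = {}"
  shows "tiles H D (\<Union>h\<in>H. (*) h ` D)" "sign_system (\<Union>h\<in>H. (*) h ` D) A"
proof -
  have neg: "(*) (- h) ` D = uminus ` (*) h ` D" for h
    by (simp add: image_image)
  have dis: "(*) g ` D \<inter> (*) h ` D = {}" if "g \<in> H \<union> uminus ` H" "h \<in> H \<union> uminus ` H" "g \<noteq> h" for g h
    using assms(1) that unfolding tiles_def disjoint_family_on_def by blast
  show "tiles H D (\<Union>h\<in>H. (*) h ` D)"
    using assms(1) dis unfolding tiles_def disjoint_family_on_def by blast
  have "(\<Union>h\<in>H. (*) h ` D) \<union> uminus ` (\<Union>h\<in>H. (*) h ` D) = A"
    using assms(1) unfolding tiles_def image_UN UN_Un neg[symmetric] by simp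
  moreover have "(\<Union>h\<in>H. (*) h ` D) \<inter> uminus ` (\<Union>h\<in>H. (*) h ` D) = {}"
  proof -
    have "(*) g ` D \<inter> (*) (- h) ` D = {}" if "g \<in> H" "h \<in> H" for g h
      using that assms(2) by (intro dis) auto
    then show ?thesis unfolding image_UN neg[symmetric] by blast
  qed
  ultimately show "sign_system (\<Union>h\<in>H. (*) h ` D) A" unfolding sign_system_def ..
qed

text \<open>When -1 is not an n-th power, negation fixes no class modulo n-th powers. Half of the
  representatives can be kept and the other half replaced by their negatives.\<close>

lemma power_transversal_sign:
  assumes "power_transversal n (C :: 'a::field set)" "finite C" "- 1 \<notin> (nth_powers n :: 'a::field set)"
  obtains H :: "'a::field set" where "H \<inter> uminus ` H = {}" "power_transversal n (H \<union> uminus ` H)"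
    "finite H" "card C = 2 * card H"
proof -
  have C0: "c \<noteq> 0" if "c \<in> C" for c using assms(1) that by (auto simp: power_transversal_def)
  obtain \<rho> :: "'a \<Rightarrow> 'a" where \<rho>: "\<And>x. x \<noteq> 0 \<Longrightarrow> \<rho> x \<in> C" "\<And>x. x \<noteq> 0 \<Longrightarrow> x / \<rho> x \<in> nth_powers n"
    and \<rho>_eq: "\<And>x c. c \<in> C \<Longrightarrow> x / c \<in> nth_powers n \<Longrightarrow> \<rho> x = c"
    using assms(1) by (rule power_transversal_rep) blast
  define \<sigma> where "\<sigma> c = \<rho> (- c)" for c
  have \<sigma>: "\<sigma> c \<in> C" "- c / \<sigma> c \<in> nth_powers n" if "c \<in> C" for c
    unfolding \<sigma>_def using \<rho>[of "- c"] C0[OF that] by simp_all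
  have inv: "\<sigma> (\<sigma> c) = c" if "c \<in> C" for c
  proof -
    have "- \<sigma> c / c \<in> nth_powers n"
      using nth_powers_divide[OF one_in_nth_powers \<sigma>(2)[OF that]] by simp
    then show ?thesis unfolding \<sigma>_def[of "\<sigma> c"] by (rule \<rho>_eq[OF that])
  qed
  have "\<sigma> c \<noteq> c" if "c \<in> C" for c
    using \<sigma>(2)[OF that] assms(3) C0[OF that] by auto
  with assms(2) \<sigma>(1) inv obtain H where H: "H \<subseteq> C" "C = H \<union> \<sigma> ` H" "H \<inter> \<sigma> ` H = {}"
    "card C = 2 * card H"
    by (rule fixpoint_free_involution_half)
  have HC: "h \<in> C" "h \<noteq> 0" if "h \<in> H" for h using that H(1) C0 by blast+
  \<comment> \<open>The elements \<open>\<sigma> h\<close> and \<open>- h\<close> represent the same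
    class.\<close>
  have step: "x / \<sigma> h \<in> nth_powers n \<longleftrightarrow> - x / h \<in> nth_powers n" if "h \<in> H" for x h
  proof
    have nz: "\<sigma> h \<noteq> 0" "h \<noteq> 0" using C0 \<sigma>(1) HC[OF that] by blast+
    assume "x / \<sigma> h \<in> nth_powers n"
    from nth_powers_divide[OF this \<sigma>(2)[OF HC(1)[OF that]]]
    show "- x / h \<in> nth_powers n" using nz by simp
  next
    have nz: "\<sigma> h \<noteq> 0" "h \<noteq> 0" using C0 \<sigma>(1) HC[OF that] by blast+
    assume "- x / h \<in> nth_powers n"
    from nth_powers_mult[OF this \<sigma>(2)[OF HC(1)[OF that]]]
    show "x / \<sigma> h \<in> nth_powers n" using nz by simp
  qed
  have no_neg: False if "g \<in> H" "h \<in> H" "x / g \<in> nth_powers n" "- x / h \<in> nth_powers n" for g h x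
  proof -
    have "x / \<sigma> h \<in> nth_powers n" using step that by blast
    from power_transversal_unique[OF assms(1) HC(1)[OF that(1)] \<sigma>(1)[OF HC(1)[OF that(2)]] that(3) this]
    show False using H(3) that by blast
  qed
  have "H \<inter> uminus ` H = {}"
  proof (rule equals0I)
    fix g assume "g \<in> H \<inter> uminus ` H"
    then obtain h where gh: "g \<in> H" "h \<in> H" "g = - h" by blast
    then show False using no_neg[of g h g] HC by (simp add: one_in_nth_powers)
  qed
  moreover have "power_transversal n (H \<union> uminus ` H)"
    unfolding power_transversal_def
  proof (intro conjI allI impI)
    show "0 \<notin> H \<union> uminus ` H" using HC(2) by auto
    fix x :: 'a assume x: "x \<noteq> 0"
    have "\<exists>d. d \<in> H \<union> uminus ` H \<and> x / d \<in> nth_powers n"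
    proof (cases "\<rho> x \<in> H")
      case True
      then show ?thesis using \<rho>(2)[OF x] by blast
    next
      case False
      then obtain h where "h \<in> H" "\<rho> x = \<sigma> h" using \<rho>(1)[OF x] H(2) by blast
      then show ?thesis using \<rho>(2)[OF x] step[of h x] by (intro exI[of _ "- h"]) auto
    qed
    moreover have "c = d" if c: "c \<in> H \<union> uminus ` H" "x / c \<in> nth_powers n"
      and d: "d \<in> H \<union> uminus ` H" "x / d \<in> nth_powers n" for c d
    proof -
      have uniq: "g = h" if "g \<in> H" "h \<in> H" "y / g \<in> nth_powers n" "y / h \<in> nth_powers n" for y g h
        using power_transversal_unique[OF assms(1) HC(1) HC(1)] that by blast
      show ?thesis
        using c d uniq[of c d x] no_neg[of c "- d" x] no_neg[of d "- c" x] uniq[of "- c" "- d" "- x"]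
        by auto
    qed
    ultimately show "\<exists>!d. d \<in> H \<union> uminus ` H \<and> x / d \<in> nth_powers n" by blast
  qed
  moreover have "finite H" using H(1) assms(2) by (rule finite_subset)
  ultimately show ?thesis using H(4) that by blast
qed

text \<open>The complementary way of halving \<open>A\<close>: all scalars are kept and each tile is
  halved. This works because scaling commutes with negation.\<close>

lemma tiles_restrict_sign_system:
  assumes "tiles C P A" "sign_system T P"
  shows "tiles C T (\<Union>c\<in>C. (*) c ` T)" "sign_system (\<Union>c\<in>C. (*) c ` T) A"
proof -
  have TP: "T \<subseteq> P" "uminus ` T \<subseteq> P" using assms(2) by (auto simp: sign_system_def)
  have dis: "(*) c ` P \<inter> (*) d ` P = {}" if "c \<in> C" "d \<in> C" "c \<noteq> d" for c d
    using assms(1) that unfolding tiles_def disjoint_family_on_def by blast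
  have C0: "c \<noteq> 0" if "c \<in> C" for c using that assms(1) by (auto simp: tiles_def)
  show "tiles C T (\<Union>c\<in>C. (*) c ` T)"
    using assms(1) dis TP unfolding tiles_def disjoint_family_on_def by blast
  have neg: "uminus ` (*) c ` T = (*) c ` uminus ` T" for c
    by (simp add: image_image)
  have "(\<Union>c\<in>C. (*) c ` T) \<union> uminus ` (\<Union>c\<in>C. (*) c ` T) = (\<Union>c\<in>C. (*) c ` (T \<union> uminus ` T))"
    unfolding image_UN neg image_Un by blast
  also have "\<dots> = A" using assms unfolding tiles_def sign_system_def by simp
  finally have "(\<Union>c\<in>C. (*) c ` T) \<union> uminus ` (\<Union>c\<in>C. (*) c ` T) = A" .
  moreover have "(*) c ` T \<inter> (*) d ` uminus ` T = {}" if "c \<in> C" "d \<in> C" for c d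
  proof (cases "c = d")
    case True
    have "T \<inter> uminus ` T = {}" using assms(2) by (simp add: sign_system_def)
    moreover have "inj ((*) d)" using C0[OF that(2)] by (simp add: inj_def)
    ultimately show ?thesis unfolding True by (simp add: image_Int[symmetric])
  next
    case False
    then show ?thesis using dis[OF that] TP by blast
  qed
  then have "(\<Union>c\<in>C. (*) c ` T) \<inter> uminus ` (\<Union>c\<in>C. (*) c ` T) = {}"
    unfolding image_UN neg by blast
  ultimately show "sign_system (\<Union>c\<in>C. (*) c ` T) A" unfolding sign_system_def ..
qed

section \<open>Multiples of a set of representatives up to sign\<close>

context line_doubling
begin

lemma equidec_sign_system:
  assumes "definable_subset L V" "sign_system V A"
  shows "{#A#} \<asymp> {#V, V#}"
proof -
  have d: "definable_subset L (uminus ` V)" "def_iso L V (uminus ` V)"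
    using definable_subset_scale[OF assms(1), of "- 1"] def_iso_scale[OF assms(1), of "- 1"] by simp_all
  have "{#A#} \<asymp> {#V, uminus ` V#}"
    using equidec_Un[OF assms(1) d(1)] assms(2) by (simp add: sign_system_def)
  also have "{#V, uminus ` V#} = {#V#} + {#uminus ` V#}" by simp
  also have "\<dots> \<asymp> {#V#} + {#V#}"
    by (intro equidec_add) (simp_all add: equidec_single_iff def_iso_refl assms(1) def_iso_sym[OF d(2)])
  finally show ?thesis by simp
qed

text \<open>For even \<open>n\<close> the roots of unity are stable under negation, with no fixed
  points as 2 is nonzero. The translates of the range \<open>S\<close> by half of them form
  \<open>V\<close>. A second set \<open>V'\<close> of representatives up to sign is built from n-th
  powers; it is isomorphic to \<open>V\<close> by \<open>sign_system_iso\<close>, and counting its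
  pieces gives \<open>l\<close> copies of \<open>V\<close>.\<close>

lemma even_root_sign_system:
  assumes "2 \<noteq> (0 :: 'a)" "even n" "n > 0" "has_definable_root L n"
    and "finite (power_cosets n :: 'a set set)"
    and "card (power_cosets n :: 'a set set) = l * num_roots_of_unity TYPE('a) n"
  obtains V where "definable_subset L V" "sign_system V (UNIV - {0})" "{#V#} \<asymp> replicate_mset l V"
proof -
  obtain C :: "'a set" and S where C: "power_transversal n C" "finite C"
    "card C = card (power_cosets n :: 'a set set)"
    and S: "def_iso L (nth_powers n) S" "tiles {x. x ^ n = 1} S (UNIV - {0})"
    using assms(4,3,5) by (rule root_data)
  note dS = def_iso_definable[OF S(1)]
  obtain H where H: "{x :: 'a. x ^ n = 1} = H \<union> uminus ` H" "H \<inter> uminus ` H = {}"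
    "card {x :: 'a. x ^ n = 1} = 2 * card H"
  proof (rule fixpoint_free_involution_half[of "{x :: 'a. x ^ n = 1}" uminus])
    show "finite {x :: 'a. x ^ n = 1}" using assms(3) by (rule finite_roots_of_unity)
    show "- c \<in> {x. x ^ n = 1}" if "c \<in> {x :: 'a. x ^ n = 1}" for c
      using that assms(2) by simp
    show "- c \<noteq> c" if "c \<in> {x :: 'a. x ^ n = 1}" for c
    proof
      assume "- c = c"
      then have "c + c = 0" unfolding eq_neg_iff_add_eq_0[symmetric] by (rule sym)
      then have "2 * c = 0" unfolding mult_2 .
      then have "c = 0" using assms(1) by simp
      then show False using that assms(3) by (simp add: power_0_left)
    qed
  qed auto
  define V where "V = (\<Union>h\<in>H. (*) h ` S)"
  have V: "tiles H S V" "sign_system V (UNIV - {0})"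
    unfolding V_def by (rule tiles_sign_system[OF _ H(2)], use S(2) H(1) in simp)+
  have dV: "definable_subset L V" using V(1) dS(2) by (rule tiles_definable)
  have VS: "{#V#} \<asymp> replicate_mset (card H) S" using V(1) dS(2) by (rule equidec_tiles)
  have card: "card C = l * (2 * card H)"
    using C(3) assms(6) H(3) by (simp add: num_roots_of_unity_def)
  have "{#V#} \<asymp> replicate_mset l V"
  proof (cases "- 1 \<in> (nth_powers n :: 'a set)")
    case True
    \<comment> \<open>Here the n-th powers are stable under negation, so every coset can be halved.
      The number of copies of \<open>T\<close> in \<open>V'\<close> is \<open>card C\<close>, that
      is twice \<open>l * card H\<close>, and two copies of \<open>T\<close> make one copy of the
      n-th powers.\<close>
    define T where "T = nth_powers n \<inter> V"
    have T: "sign_system T (nth_powers n)"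
    proof (rule sign_systemI)
      show "- x \<in> nth_powers n" if "x \<in> nth_powers n" for x :: 'a
        using nth_powers_mult[OF True that] by simp
      then show "- x \<in> T" if "x \<in> nth_powers n" "x \<notin> T" for x
        using that sign_system_minus[OF V(2), of x] nth_powers_nonzero[of x n] by (auto simp: T_def)
      show "- x \<notin> T" if "x \<in> T" for x
        using that sign_system_neg[OF V(2), of x] by (auto simp: T_def)
    qed (auto simp: T_def)
    have dT: "definable_subset L T" unfolding T_def using dS(1) dV by (rule definable_subset_Int)
    define V' where "V' = (\<Union>c\<in>C. (*) c ` T)"
    have V': "tiles C T V'" "sign_system V' (UNIV - {0})"
      unfolding V'_def by (rule tiles_restrict_sign_system[OF tiles_powers[OF C(1,2)] T])+
    have "def_iso L V V'"
      using V(2) V'(2) dV tiles_definable[OF V'(1) dT] by (rule sign_system_iso)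
    then have "{#V#} \<asymp> {#V'#}" by (simp add: equidec_single_iff)
    also have "\<dots> \<asymp> replicate_mset (card C) T" using V'(1) dT by (rule equidec_tiles)
    also have "\<dots> = repeat_mset l (repeat_mset (card H) {#T, T#})"
      unfolding card by (rule multiset_eqI) simp
    also have "\<dots> \<asymp> repeat_mset l (replicate_mset (card H) (nth_powers n))"
      using dT T by (intro equidec_repeat equidec_sym[OF equidec_replicate] equidec_sign_system)
    also have "\<dots> \<asymp> repeat_mset l (replicate_mset (card H) S)"
      using S(1) by (intro equidec_repeat equidec_replicate_iso)
    also have "\<dots> \<asymp> replicate_mset l V" using VS by (intro equidec_sym[OF equidec_replicate])
    finally show ?thesis .
  next
    case False
    \<comment> \<open>Now opposite elements lie in different cosets, so \<open>V'\<close> can be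
      made of half of the cosets, \<open>l * card H\<close> in number.\<close>
    obtain H' :: "'a set" where H': "H' \<inter> uminus ` H' = {}" "power_transversal n (H' \<union> uminus ` H')"
      "finite H'" "card C = 2 * card H'"
      using C(1,2) False by (rule power_transversal_sign)
    define V' where "V' = (\<Union>c\<in>H'. (*) c ` nth_powers n)"
    have "finite (H' \<union> uminus ` H')" using H'(3) by simp
    note tiles_sign_system[OF tiles_powers[OF H'(2) this] H'(1)]
    then have V': "tiles H' (nth_powers n) V'" "sign_system V' (UNIV - {0})"
      unfolding V'_def .
    have "def_iso L V V'"
      using V(2) V'(2) dV tiles_definable[OF V'(1) dS(1)] by (rule sign_system_iso)
    then have "{#V#} \<asymp> {#V'#}" by (simp add: equidec_single_iff)
    also have "\<dots> \<asymp> replicate_mset (card H') (nth_powers n)" using V'(1) dS(1) by (rule equidec_tiles)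
    also have "\<dots> \<asymp> replicate_mset (card H') S" using S(1) by (rule equidec_replicate_iso)
    also have "\<dots> = repeat_mset l (replicate_mset (card H) S)"
      using H'(4) card by (simp add: repeat_replicate_mset)
    also have "\<dots> \<asymp> replicate_mset l V" using VS by (intro equidec_sym[OF equidec_replicate])
    finally show ?thesis .
  qed
  then show ?thesis using that dV V(2) by blast
qed

end

section \<open>Valued fields with a least positive value\<close>

locale definable_valued_field = valued_field v
  for v :: "'a::field \<Rightarrow> 'g::linordered_ab_group_add with_infty" +
  fixes L :: "('f, 'r, 'a) ring_expansion" and \<pi> :: 'a and \<gamma> :: 'g
  assumes \<gamma>_pos: "\<gamma> > 0" and \<gamma>_least: "\<And>h. h \<in> value_group v \<Longrightarrow> h > 0 \<Longrightarrow> \<gamma> \<le> h"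
    and val_\<pi>: "v \<pi> = Fin \<gamma>"
    and definable_val_ring: "definable_subset L (val_ring v)"
begin

section \<open>The maximal ideal and its generator\<close>

lemma \<pi>_nonzero: "\<pi> \<noteq> 0"
  using val_\<pi> by auto

lemma val_ring_fin: "v x = Fin g \<Longrightarrow> x \<in> val_ring v \<longleftrightarrow> g \<ge> 0"
  by (simp add: val_ring_def zero_with_infty_def)

lemma max_ideal_fin: "v x = Fin g \<Longrightarrow> x \<in> max_ideal v \<longleftrightarrow> g > 0"
  by (simp add: max_ideal_def zero_with_infty_def)

lemma max_ideal_subset: "max_ideal v \<subseteq> val_ring v"
  by (auto simp: max_ideal_def val_ring_def)

lemma one_notin_max_ideal: "1 \<notin> max_ideal v"
  by (simp add: max_ideal_def)

lemma val_eq_0_iff: "v x = 0 \<longleftrightarrow> x \<in> val_ring v \<and> x \<notin> max_ideal v"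
  by (auto simp: max_ideal_def val_ring_def)

text \<open>By minimality of \<open>\<gamma>\<close>, an element of positive value has value at
  least \<open>\<gamma>\<close> and stays in the valuation ring when divided by
  \<open>\<pi>\<close>.\<close>

lemma max_ideal_eq: "max_ideal v = (*) \<pi> ` val_ring v"
proof (intro equalityI subsetI)
  fix x assume x: "x \<in> max_ideal v"
  show "x \<in> (*) \<pi> ` val_ring v"
  proof (cases "x = 0")
    case True
    then show ?thesis using val_ring_closed(1) by (intro image_eqI[of _ _ 0]) simp_all
  next
    case False
    then obtain h where h: "v x = Fin h" using val_fin by blast
    then have "h \<in> value_group v" "h > 0" using x by (auto simp: value_group_def max_ideal_fin)
    then have "\<gamma> \<le> h" using \<gamma>_least by blast
    moreover have "v (x * inverse \<pi>) = Fin (h - \<gamma>)"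
      by (simp add: val_mult h val_inverse[OF val_\<pi>])
    ultimately have "x * inverse \<pi> \<in> val_ring v" by (simp add: val_ring_fin)
    moreover have "x = \<pi> * (x * inverse \<pi>)" using \<pi>_nonzero by simp
    ultimately show ?thesis by blast
  qed
next
  fix x assume "x \<in> (*) \<pi> ` val_ring v"
  then obtain y where y: "y \<in> val_ring v" "x = \<pi> * y" by blast
  have "\<pi> \<in> max_ideal v" using max_ideal_fin[OF val_\<pi>] \<gamma>_pos by simp
  from max_ideal_closed(4)[OF this y(1)] show "x \<in> max_ideal v" unfolding y(2) .
qed

lemma \<pi>_mult_mem: "x \<in> val_ring v \<Longrightarrow> \<pi> * x \<in> max_ideal v"
  unfolding max_ideal_eq by blast

lemma one_plus_\<pi>:
  assumes "x \<in> val_ring v"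
  shows "1 + \<pi> * x \<in> val_ring v" "1 + \<pi> * x \<notin> max_ideal v"
proof -
  have m: "\<pi> * x \<in> max_ideal v" using assms by (rule \<pi>_mult_mem)
  then show "1 + \<pi> * x \<in> val_ring v" using max_ideal_subset val_ring_closed by blast
  show "1 + \<pi> * x \<notin> max_ideal v"
    using max_ideal_closed(3)[OF _ max_ideal_closed(2)[OF m], of "1 + \<pi> * x"] one_notin_max_ideal by auto
qed

lemma notin_val_ring_iff: "x \<notin> val_ring v \<longleftrightarrow> x \<noteq> 0 \<and> 1 / x \<in> max_ideal v"
proof (cases "x = 0")
  case True
  then show ?thesis using val_ring_closed(1) by simp
next
  case False
  then obtain h where h: "v x = Fin h" using val_fin by blast
  from val_inverse[OF h] have "v (1 / x) = Fin (- h)" by (simp add: inverse_eq_divide)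
  then show ?thesis using val_ring_fin[OF h] max_ideal_fin[of "1 / x" "- h"] False by auto
qed

text \<open>The value of a square root would be positive with double equal to
  \<open>\<gamma>\<close>, hence smaller than \<open>\<gamma>\<close>.\<close>

lemma \<pi>_not_square: "x ^ 2 \<noteq> \<pi>"
proof
  assume x: "x ^ 2 = \<pi>"
  then have "x \<noteq> 0" using \<pi>_nonzero by auto
  then obtain h where h: "v x = Fin h" using val_fin by blast
  have "v \<pi> = Fin (h + h)" unfolding x[symmetric] by (simp add: power2_eq_square val_mult h)
  then have eq: "\<gamma> = h + h" using val_\<pi> by simp
  have "h > 0"
  proof (rule ccontr)
    assume "\<not> h > 0"
    then have "h + h \<le> 0" by (simp add: add_nonpos_nonpos)
    then show False using eq \<gamma>_pos by simp
  qed
  moreover have "h \<in> value_group v" using h by (auto simp: value_group_def)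
  ultimately show False using \<gamma>_least[of h] eq by simp
qed

text \<open>The line is folded into the valuation ring, and the valuation ring has the two disjoint copies
  \<open>\<pi> R\<close> and \<open>1 + \<pi> R\<close> inside itself.\<close>

definition fold_line :: "'a \<Rightarrow> 'a" where
  "fold_line x = (if x \<in> val_ring v then 1 + \<pi> * x else 1 / x)"

lemma fold_line_mem: "fold_line x \<in> val_ring v"
  using one_plus_\<pi>(1)[of x] notin_val_ring_iff[of x] max_ideal_subset by (auto simp: fold_line_def)

text \<open>The maximal ideal separates the two branches: it contains the inverses of the elements
  outside the valuation ring but no \<open>1 + \<pi> * x\<close> with \<open>x\<close> in the
  valuation ring.\<close>

lemma inj_fold_line: "fold_line x = fold_line y \<Longrightarrow> x = y"
  using one_plus_\<pi>(2)[of x] one_plus_\<pi>(2)[of y] notin_val_ring_iff[of x] notin_val_ring_iff[of y] \<pi>_nonzero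
  by (auto simp: fold_line_def split: if_splits)

definition copy_line :: "'a \<Rightarrow> 'a \<Rightarrow> 'a" where
  "copy_line c x = c + \<pi> * fold_line x"

text \<open>The division is cleared by multiplying with \<open>x\<close>, which is nonzero outside
  the valuation ring. This leaves polynomial equations and membership in the valuation ring, so
  definability can be read off.\<close>

lemma copy_line_graph:
  "a = copy_line c x \<longleftrightarrow>
     x \<in> val_ring v \<and> a = c + \<pi> * (1 + \<pi> * x) \<or> \<not> x \<in> val_ring v \<and> a * x = c * x + \<pi>"
  using notin_val_ring_iff[of x] by (auto simp: copy_line_def fold_line_def field_simps)

lemma definable_copy_line: "definable_fun L (copy_line c) UNIV"
  unfolding definable_fun_def copy_line_graph
  by (intro definable_pred_conj definable_pred_disj definable_pred_not definable_pred_eq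
      definable_pred_mem definable_val_ring definable_trm_add definable_trm_mult definable_trm_var
      definable_trm_const definable_subset_UNIV)

lemma inj_copy_line: "inj (copy_line c)"
  using \<pi>_nonzero by (auto simp: inj_def copy_line_def dest: inj_fold_line)

text \<open>The maximal ideal also separates the two copies: \<open>copy_line 0\<close> maps into
  it, whereas \<open>copy_line 1\<close> maps into \<open>1 + \<pi> R\<close>.\<close>

sublocale line_doubling L "copy_line 1" "copy_line 0"
proof (unfold_locales, safe intro!: definable_copy_line inj_copy_line)
  fix x y
  assume "copy_line 1 x = copy_line 0 y"
  then show "copy_line 1 x \<in> {}"
    using one_plus_\<pi>(2)[OF fold_line_mem[of x]] \<pi>_mult_mem[OF fold_line_mem[of y]]
    by (simp add: copy_line_def)
qed

notation equidec (infix "\<asymp>" 50)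

lemma def_iso_one_plus_\<pi>: "def_iso L (val_ring v) ((\<lambda>x. 1 + \<pi> * x) ` val_ring v)"
  by (rule def_isoI[of _ "\<lambda>x. 1 + \<pi> * x" "val_ring v"])
    (use \<pi>_nonzero in \<open>auto intro!: definable_fun_trm definable_intros definable_val_ring inj_onI\<close>)

section \<open>Residue classes and the angular component\<close>

definition residue_class :: "'a \<Rightarrow> 'a set" where
  "residue_class x = (\<lambda>m. m + x) ` max_ideal v"

lemma residue_class_coset: "residue_class x = max_ideal v +>\<^bsub>val_subring v\<^esub> x"
  by (auto simp: residue_class_def a_r_coset_def' ring_of_type_algebra_def)

lemma residue_class_eq_iff: "residue_class x = residue_class y \<longleftrightarrow> x - y \<in> max_ideal v"
proof
  assume "residue_class x = residue_class y"
  moreover have "x \<in> residue_class x"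
    unfolding residue_class_def using max_ideal_closed(1) by (intro image_eqI[of _ _ 0]) simp_all
  ultimately obtain m where "m \<in> max_ideal v" "x = m + y" unfolding residue_class_def by blast
  then show "x - y \<in> max_ideal v" by simp
next
  have *: "residue_class x \<subseteq> residue_class y" if xy: "x - y \<in> max_ideal v" for x y
  proof
    fix z assume "z \<in> residue_class x"
    then obtain m where m: "m \<in> max_ideal v" "z = m + x" unfolding residue_class_def by blast
    then have "z = (m + (x - y)) + y" by simp
    then show "z \<in> residue_class y"
      using max_ideal_closed(3)[OF m(1) xy] unfolding residue_class_def by (rule image_eqI)
  qed
  assume "x - y \<in> max_ideal v"
  then show "residue_class x = residue_class y"
    using *[of x y] *[of y x] max_ideal_closed(2)[of "x - y"] by simp
qed

lemma carrier_residue_field: "carrier (residue_field v) = residue_class ` val_ring v"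
  by (auto simp: residue_field_def FactRing_def A_RCOSETS_def' residue_class_coset)

lemma one_residue_field: "\<one>\<^bsub>residue_field v\<^esub> = residue_class 1"
  by (simp add: residue_field_def FactRing_def residue_class_coset) (simp add: ring_of_type_algebra_def)

lemma zero_residue_field: "\<zero>\<^bsub>residue_field v\<^esub> = residue_class 0"
  by (simp add: residue_field_def FactRing_def residue_class_def)

lemma angular_component_mult:
  assumes "angular_component v ac" "x \<noteq> 0" "y \<noteq> 0"
  shows "ac (x * y) = ac x \<otimes>\<^bsub>residue_field v\<^esub> ac y"
  using assms unfolding angular_component_def hom_def by (auto simp: ring_of_type_algebra_def)

lemma angular_component_carrier:
  assumes "angular_component v ac" "x \<noteq> 0"
  shows "ac x \<in> carrier (Multiplicative_Group.mult_of (residue_field v))"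
  using assms unfolding angular_component_def hom_def by (auto simp: ring_of_type_algebra_def)

lemma angular_component_unit:
  assumes "angular_component v ac" "x \<in> val_ring v" "x \<notin> max_ideal v"
  shows "ac x = residue_class x"
  using assms val_eq_0_iff[of x] unfolding angular_component_def residue_class_coset by blast

text \<open>The nonzero class \<open>ac \<pi>\<close> is the residue of a unit \<open>u\<close>, and
  on units \<open>ac\<close> is the residue map. Dividing \<open>\<pi>\<close> by \<open>u\<close>
  therefore makes the angular component 1.\<close>

lemma normalized_uniformizer:
  assumes ac: "angular_component v ac"
  obtains \<pi>' u where "u \<in> val_ring v" "u \<notin> max_ideal v" "\<pi> = \<pi>' * u" "\<pi>' \<noteq> 0" "ac \<pi>' = \<one>\<^bsub>residue_field v\<^esub>"
proof -
  interpret k: group "Multiplicative_Group.mult_of (residue_field v)"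
    using field_residue_field by (rule field.field_mult_group)
  have ac_\<pi>: "ac \<pi> \<in> carrier (Multiplicative_Group.mult_of (residue_field v))"
    using ac \<pi>_nonzero by (rule angular_component_carrier)
  then obtain u where u: "u \<in> val_ring v" "ac \<pi> = residue_class u" "residue_class u \<noteq> residue_class 0"
    unfolding Multiplicative_Group.carrier_mult_of carrier_residue_field zero_residue_field by blast
  have uM: "u \<notin> max_ideal v" using u(3) residue_class_eq_iff[of u 0] by simp
  have u0: "u \<noteq> 0" using uM max_ideal_closed(1) by auto
  define \<pi>' where "\<pi>' = \<pi> / u"
  have \<pi>': "\<pi> = \<pi>' * u" "\<pi>' \<noteq> 0" using u0 \<pi>_nonzero by (simp_all add: \<pi>'_def)
  \<comment> \<open>As \<open>ac u = ac \<pi>\<close>, multiplicativity at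
    \<open>\<pi> = \<pi>' * u\<close> gives an equation from which \<open>ac \<pi>\<close>
    cancels.\<close>
  have "ac \<pi>' \<otimes>\<^bsub>residue_field v\<^esub> ac \<pi> = ac \<pi>"
    using angular_component_mult[OF ac \<pi>'(2) u0] angular_component_unit[OF ac u(1) uM] u(2) \<pi>'(1) by simp
  then have "ac \<pi>' = \<one>\<^bsub>residue_field v\<^esub>"
    using k.r_cancel_one[OF ac_\<pi> angular_component_carrier[OF ac \<pi>'(2)]] by simp
  then show ?thesis using that u(1) uM \<pi>' by blast
qed

text \<open>The elements of \<open>R\<^sup>(\<^sup>1\<^sup>)\<close> of value 0 form \<open>1 + \<pi> R\<close>, and those of positive value form
  \<open>\<pi>' R\<^sup>(\<^sup>1\<^sup>)\<close>.\<close>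

lemma angular_component_one_split:
  assumes ac: "angular_component v ac"
  defines "A \<equiv> {x \<in> val_ring v. ac x = \<one>\<^bsub>residue_field v\<^esub>}"
  obtains \<pi>' where "\<pi>' \<noteq> 0" "0 \<notin> A" "A = (\<lambda>x. 1 + \<pi> * x) ` val_ring v \<union> (*) \<pi>' ` A"
    "(\<lambda>x. 1 + \<pi> * x) ` val_ring v \<inter> (*) \<pi>' ` A = {}"
proof -
  obtain \<pi>' u where u: "u \<in> val_ring v" "u \<notin> max_ideal v" and \<pi>': "\<pi> = \<pi>' * u" "\<pi>' \<noteq> 0"
    "ac \<pi>' = \<one>\<^bsub>residue_field v\<^esub>"
    using ac by (rule normalized_uniformizer)
  interpret k: group "Multiplicative_Group.mult_of (residue_field v)"
    using field_residue_field by (rule field.field_mult_group)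
  have u0: "u \<noteq> 0" using u(2) max_ideal_closed(1) by auto
  have inv_u: "1 / u \<in> val_ring v"
    using notin_val_ring_iff[of "1 / u"] u by auto
  have ac_\<pi>': "ac (\<pi>' * y) = ac y" if "y \<noteq> 0" for y
    using angular_component_mult[OF ac \<pi>'(2) that] \<pi>'(3)
      k.l_one[OF angular_component_carrier[OF ac that]] by simp
  have ac0: "ac 0 \<noteq> \<one>\<^bsub>residue_field v\<^esub>"
    using ac k.one_closed by (auto simp: angular_component_def)
  then have zero: "0 \<notin> A" by (simp add: A_def)
  have \<pi>'_mem: "\<pi>' * y \<in> max_ideal v" if "y \<in> val_ring v" for y
  proof -
    have "\<pi>' * y = \<pi> * (y * (1 / u))" using u0 \<pi>'(1) by simp
    then show ?thesis using \<pi>_mult_mem[OF val_ring_closed(5)[OF that inv_u]] by simp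
  qed
  have sub: "A \<subseteq> (\<lambda>x. 1 + \<pi> * x) ` val_ring v \<union> (*) \<pi>' ` A"
  proof
    fix x assume "x \<in> A"
    then have x: "x \<in> val_ring v" "ac x = \<one>\<^bsub>residue_field v\<^esub>" by (auto simp: A_def)
    show "x \<in> (\<lambda>x. 1 + \<pi> * x) ` val_ring v \<union> (*) \<pi>' ` A"
    proof (cases "x \<in> max_ideal v")
      case True
      then obtain r where r: "r \<in> val_ring v" "x = \<pi> * r" unfolding max_ideal_eq by blast
      \<comment> \<open>Passing from \<open>\<pi>\<close> to \<open>\<pi>'\<close> moves
        \<open>u\<close> into the cofactor, which then has the same angular component as
        \<open>x\<close>.\<close>
      have "x = \<pi>' * (u * r)" unfolding r(2) \<pi>'(1) by (simp add: mult.assoc)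
      moreover have "u * r \<noteq> 0" using ac0 x(2) calculation by auto
      then have "ac (u * r) = ac x" using ac_\<pi>' calculation by simp
      then have "u * r \<in> A" using val_ring_closed(5)[OF u(1) r(1)] x(2) by (simp add: A_def)
      ultimately show ?thesis by blast
    next
      case False
      then have "residue_class x = residue_class 1"
        using angular_component_unit[OF ac x(1)] x(2) one_residue_field by simp
      then obtain r where "r \<in> val_ring v" "x - 1 = \<pi> * r"
        unfolding residue_class_eq_iff max_ideal_eq by blast
      moreover from this(2) have "x = 1 + \<pi> * r" by (simp add: algebra_simps)
      ultimately show ?thesis by blast
    qed
  qed
  have "1 + \<pi> * x \<in> A" if "x \<in> val_ring v" for x
  proof -
    have "ac (1 + \<pi> * x) = residue_class (1 + \<pi> * x)"
      using one_plus_\<pi>[OF that] by (rule angular_component_unit[OF ac])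
    also have "\<dots> = residue_class 1"
      unfolding residue_class_eq_iff using \<pi>_mult_mem[OF that] by simp
    finally show ?thesis using one_plus_\<pi>(1)[OF that] by (simp add: A_def one_residue_field)
  qed
  moreover have "\<pi>' * y \<in> A" if "y \<in> A" for y
  proof -
    have "y \<noteq> 0" using that zero by auto
    then show ?thesis using that ac_\<pi>'[of y] \<pi>'_mem[of y] max_ideal_subset by (auto simp: A_def)
  qed
  ultimately have eq: "A = (\<lambda>x. 1 + \<pi> * x) ` val_ring v \<union> (*) \<pi>' ` A"
    using sub by blast
  have "(\<lambda>x. 1 + \<pi> * x) ` val_ring v \<inter> (*) \<pi>' ` A = {}"
  proof -
    have "1 + \<pi> * x \<noteq> \<pi>' * y" if "x \<in> val_ring v" "y \<in> A" for x y
      using one_plus_\<pi>(2)[OF that(1)] \<pi>'_mem[of y] that(2) by (auto simp: A_def)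
    then show ?thesis by blast
  qed
  with \<pi>'(2) zero eq show ?thesis by (rule that)
qed

section \<open>Decompositions of the punctured valuation ring\<close>

abbreviation punctured_ring :: "'a set" where
  "punctured_ring \<equiv> val_ring v - {0}"

lemma definable_punctured_ring: "definable_subset L punctured_ring"
  by (intro definable_subset_Diff definable_val_ring definable_subset_singleton)

text \<open>The set \<open>A\<close> of elements with angular component 1 absorbs a copy of the
  valuation ring. It lies in \<open>punctured_ring\<close>, whose remaining elements are carried
  along unchanged, so \<open>punctured_ring\<close> absorbs the same copy, itself made of
  \<open>punctured_ring\<close> and a point.\<close>

lemma punctured_ring_absorbs:
  assumes ac: "angular_component v ac"
    and def: "definable_subset L {x \<in> val_ring v. ac x = \<one>\<^bsub>residue_field v\<^esub>}"
  shows "{#punctured_ring#} \<asymp> {#punctured_ring, punctured_ring, {0}#}"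
proof -
  let ?B = punctured_ring
  define A where "A = {x \<in> val_ring v. ac x = \<one>\<^bsub>residue_field v\<^esub>}"
  obtain \<pi>' where \<pi>': "\<pi>' \<noteq> 0" "0 \<notin> A" "A = (\<lambda>x. 1 + \<pi> * x) ` val_ring v \<union> (*) \<pi>' ` A"
    "(\<lambda>x. 1 + \<pi> * x) ` val_ring v \<inter> (*) \<pi>' ` A = {}"
    unfolding A_def using ac by (rule angular_component_one_split)
  have dA: "definable_subset L A" unfolding A_def by (rule def)
  have d: "definable_subset L (?B - A)" by (intro definable_subset_Diff definable_punctured_ring dA)
  have rf: "{#C#} \<asymp> {#C#}" if "definable_subset L C" for C
    using that by (simp add: equidec_single_iff def_iso_refl)
  have "{#A#} \<asymp> {#(\<lambda>x. 1 + \<pi> * x) ` val_ring v, (*) \<pi>' ` A#}"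
    using equidec_Un[OF def_iso_definable(2)[OF def_iso_one_plus_\<pi>] definable_subset_scale[OF dA \<pi>'(1)] \<pi>'(4)]
      \<pi>'(3) by simp
  also have "\<dots> = {#(\<lambda>x. 1 + \<pi> * x) ` val_ring v#} + {#(*) \<pi>' ` A#}" by simp
  also have "\<dots> \<asymp> {#val_ring v#} + {#A#}"
    by (intro equidec_add)
      (simp_all add: equidec_single_iff def_iso_sym def_iso_one_plus_\<pi> def_iso_scale dA \<pi>'(1))
  finally have A: "{#A#} \<asymp> {#val_ring v#} + {#A#}" .
  have "{#insert 0 ?B#} \<asymp> {#?B, {0}#}"
    using equidec_Un[OF definable_punctured_ring definable_subset_singleton, of 0] by simp
  then have R: "{#val_ring v#} \<asymp> {#?B, {0}#}"
    using val_ring_closed(1) by (simp add: insert_absorb)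
  have "A \<union> (?B - A) = ?B" using \<pi>'(2) by (auto simp: A_def)
  then have B: "{#?B#} \<asymp> {#A, ?B - A#}"
    using equidec_Un[OF dA d] by simp
  also have "\<dots> = {#A#} + {#?B - A#}" by simp
  also have "\<dots> \<asymp> ({#val_ring v#} + {#A#}) + {#?B - A#}"
    by (intro equidec_add A rf d)
  also have "\<dots> = {#val_ring v#} + {#A, ?B - A#}" by simp
  also have "\<dots> \<asymp> {#?B, {0}#} + {#?B#}"
    by (intro equidec_add R equidec_sym[OF B])
  finally show ?thesis by (simp add: add_mset_commute)
qed

text \<open>Inversion carries the part \<open>W\<close> of \<open>V\<close> outside the valuation
  ring to representatives up to sign of the nonzero elements of the maximal ideal. The multiples by
  \<open>\<pi>\<close> of the other part \<open>U\<close> are such representatives too, so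
  \<open>W\<close> is isomorphic to \<open>U\<close>. Hence \<open>V\<close> amounts to two copies
  of \<open>U\<close>, and so does \<open>punctured_ring\<close>, which is \<open>U\<close> together
  with its negative.\<close>

lemma units_sign_system_iso:
  assumes V: "definable_subset L V" "sign_system V (UNIV - {0})"
  shows "{#V#} \<asymp> {#punctured_ring#}"
proof -
  define U where "U = V \<inter> val_ring v"
  define W where "W = V - val_ring v"
  have d: "definable_subset L U" "definable_subset L W"
    unfolding U_def W_def using V(1) definable_val_ring
    by (auto intro: definable_subset_Int definable_subset_Diff)
  have V0: "x \<noteq> 0" if "x \<in> V" for x using V(2) that by (auto simp: sign_system_def)
  have neg: "- x \<in> val_ring v \<longleftrightarrow> x \<in> val_ring v" for x
    using val_ring_closed(3)[of x] val_ring_closed(3)[of "- x"] by auto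
  have U: "sign_system U punctured_ring"
  proof (rule sign_systemI)
    show "- x \<in> punctured_ring" if "x \<in> punctured_ring" for x using that neg by simp
    show "U \<subseteq> punctured_ring" using V0 by (auto simp: U_def)
    show "- x \<in> U" if "x \<in> punctured_ring" "x \<notin> U" for x
      using that sign_system_minus[OF V(2), of x] neg by (auto simp: U_def)
    show "- x \<notin> U" if "x \<in> U" for x
      using that sign_system_neg[OF V(2), of x] by (auto simp: U_def)
  qed
  have "def_iso L W ((\<lambda>x. 1 / x) ` W)"
  proof (rule def_isoI[OF _ subset_refl d(2)])
    have eq: "e 0 \<in> W \<and> e 1 = 1 / e 0 \<longleftrightarrow> e 0 \<in> W \<and> e 1 * e 0 = 1" for e :: "nat \<Rightarrow> 'a"
      using V0[of "e 0"] by (auto simp: W_def nonzero_eq_divide_eq)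
    show "definable_fun L (\<lambda>x. 1 / x) W"
      unfolding definable_fun_def eq
      by (intro definable_pred_conj definable_pred_mem definable_pred_eq definable_trm_mult
          definable_trm_var definable_trm_const d)
    show "inj_on (\<lambda>x. 1 / x) W" by (rule inj_onI) simp
  qed simp
  note W_inv = this
  have "sign_system ((\<lambda>x. 1 / x) ` W) (max_ideal v - {0})"
  proof (rule sign_systemI)
    show "- x \<in> max_ideal v - {0}" if "x \<in> max_ideal v - {0}" for x
      using that max_ideal_closed(2) by simp
    show "(\<lambda>x. 1 / x) ` W \<subseteq> max_ideal v - {0}"
      using V0 notin_val_ring_iff by (auto simp: W_def)
    show "- x \<in> (\<lambda>x. 1 / x) ` W" if "x \<in> max_ideal v - {0}" "x \<notin> (\<lambda>x. 1 / x) ` W" for x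
    proof -
      have "1 / x \<notin> val_ring v" using that(1) notin_val_ring_iff[of "1 / x"] by simp
      moreover have "1 / x \<notin> W" using that(2) by force
      ultimately have "- (1 / x) \<in> W"
        using that(1) sign_system_minus[OF V(2), of "1 / x"] neg[of "1 / x"] by (simp add: W_def)
      then show ?thesis by (intro image_eqI[of _ _ "- (1 / x)"]) simp_all
    qed
    show "- x \<notin> (\<lambda>x. 1 / x) ` W" if "x \<in> (\<lambda>x. 1 / x) ` W" for x
    proof
      assume "- x \<in> (\<lambda>x. 1 / x) ` W"
      with that obtain y z where "y \<in> W" "z \<in> W" "x = 1 / y" "- x = 1 / z" by blast
      moreover from this have "z = - y" by (metis divide_minus_right div_by_1 divide_divide_eq_right mult_1)
      ultimately show False using sign_system_neg[OF V(2), of y] by (simp add: W_def)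
    qed
  qed
  moreover have "sign_system ((*) \<pi> ` U) (max_ideal v - {0})"
  proof -
    have "tiles {\<pi>} punctured_ring (max_ideal v - {0})"
      using \<pi>_nonzero by (auto simp: tiles_def disjoint_family_on_def max_ideal_eq)
    from tiles_restrict_sign_system(2)[OF this U] show ?thesis by simp
  qed
  ultimately have "def_iso L ((\<lambda>x. 1 / x) ` W) ((*) \<pi> ` U)"
    using def_iso_definable(2)[OF W_inv] definable_subset_scale[OF d(1) \<pi>_nonzero] by (rule sign_system_iso)
  from def_iso_trans[OF def_iso_trans[OF W_inv this] def_iso_sym[OF def_iso_scale[OF d(1) \<pi>_nonzero]]]
  have WU: "{#W#} \<asymp> {#U#}" by (simp add: equidec_single_iff)
  have "U \<union> W = V" "U \<inter> W = {}" by (auto simp: U_def W_def)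
  then have "{#V#} \<asymp> {#U#} + {#W#}" using equidec_Un[OF d] by (simp add: add_mset_commute)
  also have "\<dots> \<asymp> {#U#} + {#U#}"
    by (intro equidec_add WU) (simp add: equidec_single_iff def_iso_refl d)
  also have "\<dots> = {#U, U#}" by simp
  also have "\<dots> \<asymp> {#punctured_ring#}"
    by (rule equidec_sym[OF equidec_sign_system[OF d(1) U]])
  finally show ?thesis .
qed

text \<open>The powers of \<open>\<pi>\<close> have strictly increasing values.\<close>

lemma infinite_field: "infinite (UNIV :: 'a set)"
proof
  assume fin: "finite (UNIV :: 'a set)"
  have "v (\<pi> ^ Suc k) > v (\<pi> ^ k)" for k
  proof -
    obtain h where "v (\<pi> ^ k) = Fin h" using val_fin[of "\<pi> ^ k"] \<pi>_nonzero by auto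
    then show ?thesis using \<gamma>_pos by (simp add: val_mult val_\<pi>)
  qed
  then have "strict_mono (\<lambda>k. v (\<pi> ^ k))" by (simp add: strict_mono_Suc_iff)
  then have "inj (\<lambda>k. v (\<pi> ^ k))" by (rule strict_mono_imp_inj_on)
  then have "inj (\<lambda>k. \<pi> ^ k)" by (auto simp: inj_def)
  moreover have "finite (range (\<lambda>k. \<pi> ^ k))" using fin by (rule finite_subset[OF subset_UNIV])
  ultimately show False using finite_imageD infinite_UNIV_nat by blast
qed

text \<open>If all \<open>\<lambda>\<^sub>n\<close> were odd, the group \<open>H\<close> would consist of even numbers. An odd \<open>n\<close> has an
  odd \<open>\<lambda>\<^sub>n\<close> because \<open>K\<^sup>\<times> / P\<^sub>n\<close> has exponent \<open>n\<close>; and in characteristic 2 the index of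
  \<open>P\<^sub>n\<close> is infinite for even \<open>n\<close>.\<close>

lemma even_lambda_exists:
  assumes H: "H_group L = UNIV"
  obtains n l where "even n" "n > 0" "even l" "l > 0" "2 \<noteq> (0 :: 'a)" "has_definable_root L n"
    "finite (power_cosets n :: 'a set set)"
    "card (power_cosets n :: 'a set set) = l * num_roots_of_unity TYPE('a) n"
proof -
  have "\<exists>n>1. even (lambda_num L n)"
  proof (rule ccontr)
    assume no: "\<not> (\<exists>n>1. even (lambda_num L n))"
    have "even z" if "z \<in> H_group L" for z
      using that unfolding H_group_def
    proof (induction rule: group_closure.induct)
      case (base z)
      then show ?case using no by auto
    qed simp
    from this[of 1] show False using H by simp
  qed
  then obtain n where n: "n > 1" "even (lambda_num L n)" by blast
  from n(1) show ?thesis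
  proof (cases rule: lambda_num_cases)
    case 1
    then show ?thesis using n(2) by simp
  next
    case (2 l)
    have "even l" using 2(1) n(2) by simp
    have "even n"
    proof (rule ccontr)
      assume "odd n"
      obtain C :: "'a set" and S where "power_transversal n C" "finite C"
        "card C = card (power_cosets n :: 'a set set)"
        "def_iso L (nth_powers n) S" "tiles {x. x ^ n = 1} S (UNIV - {0})"
        by (rule root_data[OF 2(3) _ 2(4)]) (use n(1) in simp)
      then show False using odd_power_index[of n C] \<open>odd n\<close> 2(5) \<open>even l\<close> by simp
    qed
    moreover have "2 \<noteq> (0 :: 'a)"
      using infinite_even_power_index_char2[OF _ infinite_field \<pi>_not_square \<open>even n\<close>] 2(4) by blast
    ultimately show ?thesis using that[of n l] n(1) 2 \<open>even l\<close> by simp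
  qed
qed

lemma punctured_ring_iso:
  assumes "angular_component v ac"
    and "definable_subset L {x \<in> val_ring v. ac x = \<one>\<^bsub>residue_field v\<^esub>}"
    and H: "H_group L = UNIV"
  shows "def_iso L (val_ring v) punctured_ring"
proof -
  let ?B = punctured_ring and ?A = "UNIV - {0 :: 'a}"
  have B: "{#?B#} \<asymp> {#?B#}" by (simp add: equidec_single_iff def_iso_refl definable_punctured_ring)
  have absorb: "{#?B#} \<asymp> {#?B, ?B, {0}#}" using assms(1,2) by (rule punctured_ring_absorbs)
  have double: "{#?A#} \<asymp> {#?A, ?A#}" using H by (rule units_equidec_double)
  obtain n l where n: "even n" "n > 0" "even l" "l > 0" "2 \<noteq> (0 :: 'a)" "has_definable_root L n"
    "finite (power_cosets n :: 'a set set)"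
    "card (power_cosets n :: 'a set set) = l * num_roots_of_unity TYPE('a) n"
    using H by (rule even_lambda_exists)
  obtain V where V: "definable_subset L V" "sign_system V ?A" "{#V#} \<asymp> replicate_mset l V"
    using n(5,1,2,6-8) by (rule even_root_sign_system)
  have VB: "{#V#} \<asymp> {#?B#}" using V(1,2) by (rule units_sign_system_iso)
  have AB: "{#?A#} \<asymp> {#?B, ?B#}"
    using equidec_trans[OF equidec_sign_system[OF V(1,2)] equidec_add[OF VB VB, simplified]] by simp
  \<comment> \<open>Undoing the doubling repeatedly, any positive number of copies of
    \<open>K\<^sup>\<times>\<close> collapses to one.\<close>
  have A: "replicate_mset (Suc k) ?A \<asymp> {#?A#}" for k
  proof (induction k)
    case 0
    show ?case using equidec_trans[OF AB equidec_sym[OF AB]] by simp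
  next
    case (Suc k)
    have "replicate_mset (Suc (Suc k)) ?A = {#?A#} + replicate_mset (Suc k) ?A" by simp
    also have "\<dots> \<asymp> {#?A#} + {#?A#}"
      using Suc equidec_trans[OF AB equidec_sym[OF AB]] by (rule equidec_add[rotated])
    also have "\<dots> \<asymp> {#?A#}" using equidec_sym[OF double] by simp
    finally show ?case .
  qed
  \<comment> \<open>Half of \<open>l\<close> is written as \<open>Suc k\<close> so that the collapse
    applies; \<open>l\<close> is even and positive, so the subtraction is exact.\<close>
  define k where "k = l div 2 - 1"
  have k: "l = Suc k * 2" using n(3,4) by (auto simp: k_def elim: evenE)
  have "{#?B#} \<asymp> replicate_mset l V" using equidec_trans[OF equidec_sym[OF VB] V(3)] .
  also have "\<dots> \<asymp> replicate_mset l ?B"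
    using VB by (intro equidec_replicate_iso) (simp add: equidec_single_iff)
  also have "\<dots> = repeat_mset (Suc k) {#?B, ?B#}"
    unfolding k by (rule multiset_eqI) simp
  also have "\<dots> \<asymp> replicate_mset (Suc k) ?A"
    by (rule equidec_sym[OF equidec_replicate[OF AB]])
  also have "\<dots> \<asymp> {#?A#}" by (rule A)
  also have "\<dots> \<asymp> {#?B, ?B#}" by (rule AB)
  finally have BB: "{#?B#} \<asymp> {#?B, ?B#}" .
  have zero: "{#{0}#} \<asymp> {#{0 :: 'a}#}"
    by (simp add: equidec_single_iff def_iso_refl definable_subset_singleton)
  \<comment> \<open>Two copies of \<open>?B\<close> shrink to one while the absorbed point stays,
    and it serves as the missing 0.\<close>
  have "{#?B#} \<asymp> {#?B, ?B#} + {#{0}#}" using absorb by (simp add: add_mset_commute)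
  also have "\<dots> \<asymp> {#?B#} + {#{0}#}"
    using equidec_sym[OF BB] zero by (rule equidec_add)
  also have "{#?B#} + {#{0}#} = {#?B, {0}#}" by (simp add: add_mset_commute)
  also have "\<dots> \<asymp> {#?B \<union> {0}#}"
    using equidec_sym[OF equidec_Un[OF definable_punctured_ring definable_subset_singleton, of 0]] by simp
  also have "?B \<union> {0} = val_ring v" using val_ring_closed(1) by auto
  finally show ?thesis by (simp add: equidec_single_iff def_iso_sym)
qed

end

section \<open>The Grothendieck ring\<close>

lemma mem_set_times_pts_iff:
  assumes "\<And>xs. xs \<in> A \<Longrightarrow> length xs = n"
  shows "ys \<in> set_times A (pts B) \<longleftrightarrow> length ys = Suc n \<and> take n ys \<in> A \<and> ys ! n \<in> B"
proof
  assume "ys \<in> set_times A (pts B)"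
  then obtain xs b where "xs \<in> A" "b \<in> B" "ys = xs @ [b]" by (auto simp: set_times_def pts_def)
  then show "length ys = Suc n \<and> take n ys \<in> A \<and> ys ! n \<in> B"
    using assms[of xs] by (simp add: nth_append)
next
  assume ys: "length ys = Suc n \<and> take n ys \<in> A \<and> ys ! n \<in> B"
  then have "ys = take n ys @ [ys ! n]" by (metis lessI take_Suc_conv_app_nth take_all_iff order_refl)
  then show "ys \<in> set_times A (pts B)" using ys unfolding set_times_def pts_def by blast
qed

lemma map_nth_upt_eq_take:
  assumes "n \<le> length xs" "n \<le> m"
  shows "map (\<lambda>i. if i < m then xs ! i else c) [0..<n] = take n xs"
  using assms by (intro nth_equalityI) auto

lemma definable_set_times:
  assumes A: "definable L n A" and B: "definable_subset L B"
  shows "definable L (Suc n) (set_times A (pts B))"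
proof (rule definable_pred_imp_definable)
  show "definable_pred L (\<lambda>e. map e [0..<n] \<in> A \<and> e n \<in> B)"
    by (intro definable_pred_conj definable_imp_definable_pred(1)[OF A] definable_pred_mem B definable_trm_var)
  show "ys \<in> set_times A (pts B) \<longleftrightarrow> length ys = Suc n \<and>
      map (\<lambda>i. if i < Suc n then ys ! i else 0) [0..<n] \<in> A \<and> (if n < Suc n then ys ! n else 0) \<in> B" for ys
    using mem_set_times_pts_iff[of A n ys B] definable_imp_definable_pred(2)[OF A]
      map_nth_upt_eq_take[of n ys "Suc n" 0] by auto
qed

text \<open>The first \<open>n\<close> coordinates are kept and the given bijection is applied to
  the last one.\<close>

lemma definable_bij_set_times:
  assumes A: "definable (L :: ('f, 'r, 'a::field) ring_expansion) n A" and BC: "def_iso L B C"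
  shows "definable_bij L (set_times A (pts B)) (set_times A (pts C))"
proof -
  obtain f where f: "bij_betw f B C" "definable_fun L f B"
    using BC unfolding def_iso_def by auto
  note len = definable_imp_definable_pred(2)[OF A]
  let ?F = "\<lambda>ys. take n ys @ [f (ys ! n)]"
  have F: "?F (xs @ [b]) = xs @ [f b]" if "xs \<in> A" for xs b
    using len[OF that] by (simp add: nth_append)
  have "bij_betw ?F (set_times A (pts B)) (set_times A (pts C))"
    unfolding bij_betw_def
  proof
    show "inj_on ?F (set_times A (pts B))"
    proof (rule inj_onI)
      fix ys zs assume *: "ys \<in> set_times A (pts B)" "zs \<in> set_times A (pts B)" "?F ys = ?F zs"
      obtain xs b where ys: "xs \<in> A" "b \<in> B" "ys = xs @ [b]"
        using *(1) unfolding set_times_def pts_def by blast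
      obtain xs' b' where zs: "xs' \<in> A" "b' \<in> B" "zs = xs' @ [b']"
        using *(2) unfolding set_times_def pts_def by blast
      have "xs = xs'" "f b = f b'"
        using *(3) unfolding ys(3) zs(3) F[OF ys(1)] F[OF zs(1)] by simp_all
      moreover have "inj_on f B" using f(1) by (simp add: bij_betw_def)
      ultimately show "ys = zs" using ys zs by (simp add: inj_on_eq_iff)
    qed
    have "?F ` set_times A (pts B) = {?F (xs @ [b]) | xs b. xs \<in> A \<and> b \<in> B}"
      unfolding set_times_def pts_def by blast
    also have "\<dots> = {xs @ [f b] | xs b. xs \<in> A \<and> b \<in> B}"
      by (intro Collect_cong iff_exI) (metis F)
    also have "\<dots> = {xs @ [c] | xs c. xs \<in> A \<and> c \<in> f ` B}" by blast
    also have "f ` B = C" using f(1) by (simp add: bij_betw_def)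
    also have "{xs @ [c] | xs c. xs \<in> A \<and> c \<in> C} = set_times A (pts C)"
      unfolding set_times_def pts_def by blast
    finally show "?F ` set_times A (pts B) = set_times A (pts C)" .
  qed
  moreover have "definable L (Suc n + Suc n) {ys @ ?F ys | ys. ys \<in> set_times A (pts B)}"
  proof (rule definable_pred_imp_definable)
    \<comment> \<open>Coordinates 0 to \<open>n\<close> hold the argument, the next \<open>n\<close>
      repeat its first \<open>n\<close> entries, and the last one holds the value of
      \<open>f\<close> at coordinate \<open>n\<close>.\<close>
    show "definable_pred L (\<lambda>e. map e [0..<n] \<in> A \<and> (e n \<in> B \<and> e (Suc n + n) = f (e n)) \<and>
        (\<forall>i<n. e (Suc n + i) = e i))"
      by (intro definable_pred_conj definable_imp_definable_pred(1)[OF A] definable_pred_graph[OF f(2)]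
          definable_pred_all_less definable_pred_eq definable_trm_var)
    fix zs :: "'a list"
    let ?e = "\<lambda>i. if i < Suc n + Suc n then zs ! i else 0"
    show "zs \<in> {ys @ ?F ys | ys. ys \<in> set_times A (pts B)} \<longleftrightarrow> length zs = Suc n + Suc n \<and>
        map ?e [0..<n] \<in> A \<and> (?e n \<in> B \<and> ?e (Suc n + n) = f (?e n)) \<and> (\<forall>i<n. ?e (Suc n + i) = ?e i)"
    proof (intro iffI conjI)
      assume "zs \<in> {ys @ ?F ys | ys. ys \<in> set_times A (pts B)}"
      then obtain xs b where *: "xs \<in> A" "b \<in> B" "zs = (xs @ [b]) @ ?F (xs @ [b])"
        unfolding set_times_def pts_def by blast
      note zs = *(1,2) *(3)[unfolded F[OF *(1)]]
      have l: "length xs = n" using zs(1) by (rule len)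
      show "length zs = Suc n + Suc n" using l zs(3) by simp
      have "map ?e [0..<n] = xs" using l zs(3) by (intro nth_equalityI) (auto simp: nth_append)
      then show "map ?e [0..<n] \<in> A" using zs(1) by simp
      show "?e n \<in> B" "?e (Suc n + n) = f (?e n)" "\<forall>i<n. ?e (Suc n + i) = ?e i"
        using l zs(2) unfolding zs(3) by (auto simp: nth_append)
    next
      assume zs: "length zs = Suc n + Suc n \<and> map ?e [0..<n] \<in> A \<and>
        (?e n \<in> B \<and> ?e (Suc n + n) = f (?e n)) \<and> (\<forall>i<n. ?e (Suc n + i) = ?e i)"
      define xs where "xs = map ?e [0..<n]"
      have l: "length xs = n" by (simp add: xs_def)
      have eq: "zs = (xs @ [?e n]) @ xs @ [f (?e n)]"
      proof (rule nth_equalityI)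
        fix i assume "i < length zs"
        then consider "i < n" | "i = n" | j where "j < n" "i = Suc n + j" | "i = Suc n + n"
          using zs by (metis add_Suc_right less_Suc_eq less_or_eq_imp_le nat_add_left_cancel_less
              le_add_diff_inverse not_less)
        then show "zs ! i = ((xs @ [?e n]) @ xs @ [f (?e n)]) ! i"
          using zs by cases (auto simp: nth_append xs_def)
      qed (use zs l in simp)
      have xs: "xs \<in> A" and "?e n \<in> B" using zs by (simp_all add: xs_def)
      then have "xs @ [?e n] \<in> set_times A (pts B)" unfolding set_times_def pts_def by blast
      moreover have "zs = (xs @ [?e n]) @ ?F (xs @ [?e n])" unfolding F[OF xs] by (rule eq)
      ultimately show "zs \<in> {ys @ ?F ys | ys. ys \<in> set_times A (pts B)}" by blast
    qed
  qed
  ultimately show ?thesis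
    unfolding definable_bij_def
    using definable_set_times[OF A def_iso_definable(1)[OF BC]] definable_set_times[OF A def_iso_definable(2)[OF BC]]
    by (intro exI[of _ "Suc n"] conjI exI[of _ ?F]) simp_all
qed

text \<open>Appending the constant \<open>c\<close> replaces any definable set by a product, to
  which a decomposition of the second factor can be applied.\<close>

lemma definable_bij_times_point:
  assumes A: "definable (L :: ('f, 'r, 'a::field) ring_expansion) n A" "n > 0"
  shows "definable_bij L A (set_times A (pts {c}))"
proof -
  note len = definable_imp_definable_pred(2)[OF A(1)]
  have "bij_betw (\<lambda>xs. xs @ [c]) A (set_times A (pts {c}))"
    by (auto simp: bij_betw_def inj_on_def set_times_def pts_def)
  moreover have "definable L (n + Suc n) {xs @ (xs @ [c]) | xs. xs \<in> A}"
  proof (rule definable_pred_imp_definable)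
    show "definable_pred L (\<lambda>e. map e [0..<n] \<in> A \<and> e (n + n) = c \<and> (\<forall>i<n. e (n + i) = e i))"
      by (intro definable_pred_conj definable_imp_definable_pred(1)[OF A(1)]
          definable_pred_all_less definable_pred_eq definable_trm_var definable_trm_const)
    fix zs :: "'a list"
    let ?e = "\<lambda>i. if i < n + Suc n then zs ! i else 0"
    show "zs \<in> {xs @ (xs @ [c]) | xs. xs \<in> A} \<longleftrightarrow> length zs = n + Suc n \<and>
        map ?e [0..<n] \<in> A \<and> ?e (n + n) = c \<and> (\<forall>i<n. ?e (n + i) = ?e i)"
    proof (intro iffI conjI)
      assume "zs \<in> {xs @ (xs @ [c]) | xs. xs \<in> A}"
      then obtain xs where zs: "xs \<in> A" "zs = xs @ xs @ [c]" by blast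
      have l: "length xs = n" using zs(1) by (rule len)
      show "length zs = n + Suc n" using l zs(2) by simp
      have "map ?e [0..<n] = xs" using l zs(2) by (intro nth_equalityI) (auto simp: nth_append)
      then show "map ?e [0..<n] \<in> A" using zs(1) by simp
      show "?e (n + n) = c" "\<forall>i<n. ?e (n + i) = ?e i"
        using l unfolding zs(2) by (auto simp: nth_append)
    next
      assume zs: "length zs = n + Suc n \<and> map ?e [0..<n] \<in> A \<and> ?e (n + n) = c \<and>
        (\<forall>i<n. ?e (n + i) = ?e i)"
      define xs where "xs = map ?e [0..<n]"
      have l: "length xs = n" by (simp add: xs_def)
      have "zs = xs @ xs @ [c]"
      proof (rule nth_equalityI)
        fix i assume "i < length zs"
        then consider "i < n" | j where "j < n" "i = n + j" | "i = n + n"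
          using zs by (metis add_Suc_right less_Suc_eq nat_add_left_cancel_less le_add_diff_inverse not_less)
        then show "zs ! i = (xs @ xs @ [c]) ! i"
          using zs by cases (auto simp: nth_append xs_def)
      qed (use zs l in simp)
      moreover have "xs \<in> A" using zs by (simp add: xs_def)
      ultimately show "zs \<in> {xs @ (xs @ [c]) | xs. xs \<in> A}" by blast
    qed
  qed
  ultimately show ?thesis
    unfolding definable_bij_def
    using A definable_set_times[OF A(1) definable_subset_singleton[of L c]]
    by (intro exI[of _ n] exI[of _ "Suc n"] conjI exI[of _ "\<lambda>xs. xs @ [c]"]) simp_all
qed

text \<open>Modulo the relations, \<open>A\<close> equals its product with the point 0, which is the
  difference of its products with \<open>B\<close> and with \<open>B - {0}\<close>. These two
  products are in definable bijection.\<close>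

lemma frag_of_mem_groth_relations:
  assumes B: "def_iso L B (B - {0})" "0 \<in> B" and A: "A \<in> definable_sets L"
  shows "frag_of A \<in> group_closure (groth_relations L)"
proof -
  obtain n where n: "n > 0" "definable L n A" using A by (auto simp: definable_sets_def)
  let ?T = "\<lambda>C. set_times A (pts C)"
  have T: "?T C \<in> definable_sets L" if "definable_subset L C" for C
    using definable_set_times[OF n(2) that] by (auto simp: definable_sets_def)
  note T = T[OF def_iso_definable(1)[OF B(1)]] T[OF def_iso_definable(2)[OF B(1)]]
    T[OF definable_subset_singleton[of L 0]]
  have "frag_of A - frag_of (?T {0}) \<in> groth_relations L"
    unfolding groth_relations_def using A T definable_bij_times_point[OF n(2,1)] by blast
  then have 1: "frag_of A - frag_of (?T {0}) \<in> group_closure (groth_relations L)"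
    by (intro group_closure.base) simp
  have "frag_of (?T B) - frag_of (?T (B - {0})) \<in> groth_relations L"
    unfolding groth_relations_def using T definable_bij_set_times[OF n(2) B(1)] by blast
  then have 2: "frag_of (?T B) - frag_of (?T (B - {0})) \<in> group_closure (groth_relations L)"
    by (intro group_closure.base) simp
  have "?T B = ?T (B - {0}) \<union> ?T {0}" "?T (B - {0}) \<inter> ?T {0} = {}"
    using B(2) by (auto simp: set_times_def pts_def)
  then have "frag_of (?T B) - (frag_of (?T (B - {0})) + frag_of (?T {0})) \<in> groth_relations L"
    unfolding groth_relations_def using T by blast
  then have 3: "frag_of (?T B) - (frag_of (?T (B - {0})) + frag_of (?T {0})) \<in> group_closure (groth_relations L)"
    by (intro group_closure.base) simp
  \<comment> \<open>The second relation minus the third leaves the product of \<open>A\<close> with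
    the point; adding the first turns this into \<open>frag_of A\<close>.\<close>
  from group_closure_add[OF 1 group_closure.diff[OF 2 3]] show ?thesis by simp
qed

text \<open>All generators lie in the subgroup spanned by the relations, hence so does every formal
  sum, and the quotient has a single coset.\<close>

lemma groth_ring_trivial:
  assumes B: "def_iso L B (B - {0})" "0 \<in> B"
  shows "carrier (groth_ring L) = {\<zero>\<^bsub>groth_ring L\<^esub>}"
proof -
  let ?I = "group_closure (groth_relations L)"
  have mem: "c \<in> ?I" if "c \<in> carrier (groth_free L)" for c
  proof -
    have "Poly_Mapping.keys c \<subseteq> definable_sets L" using that by (simp add: groth_free_def)
    then show ?thesis
      by (rule frag_induction) (simp_all add: frag_of_mem_groth_relations[OF B] group_closure.diff)
  qed
  have coset: "?I +>\<^bsub>groth_free L\<^esub> c = ?I" if "c \<in> carrier (groth_free L)" for c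
  proof -
    have "?I +>\<^bsub>groth_free L\<^esub> c = (\<lambda>h. h + c) ` ?I"
      by (auto simp: a_r_coset_def' groth_free_def)
    also have "\<dots> = ?I"
    proof (intro equalityI subsetI)
      fix x assume "x \<in> ?I"
      then have "x - c \<in> ?I" using mem[OF that] by (rule group_closure.diff)
      then show "x \<in> (\<lambda>h. h + c) ` ?I" by (intro image_eqI[of _ _ "x - c"]) simp_all
    qed (use mem[OF that] group_closure_add in blast)
    finally show ?thesis .
  qed
  have "0 \<in> carrier (groth_free L)" by (simp add: groth_free_def)
  then have "carrier (groth_ring L) = {?I}"
    using coset by (auto simp: groth_ring_def FactRing_def A_RCOSETS_def')
  then show ?thesis by (simp add: groth_ring_def FactRing_def)
qed

lemma expands_valued_field_definable:
  assumes "expands_valued_field L v"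
  shows "definable_subset L (val_ring v)"
proof -
  obtain r where r: "r \<in> rel_syms L" "rel_arity L r = 1" "\<And>x. rel_interp L r [x] \<longleftrightarrow> x \<in> val_ring v"
    using assms unfolding expands_valued_field_def by blast
  show ?thesis
    unfolding definable_subset_def by (rule definable_predI[of L "FRel r [TVar 0]" _ Inl]) (simp_all add: r)
qed

theorem proposition1:
  fixes v :: "'a::field \<Rightarrow> 'g::linordered_ab_group_add with_infty"
    and L :: "('f, 'r, 'a) ring_expansion"
    and ac :: "'a \<Rightarrow> 'a set"
    and \<pi> :: 'a and \<gamma> :: 'g
  assumes "valued_field v"
    and "\<gamma> \<in> value_group v" and "\<gamma> > 0" and "\<forall>h\<in>value_group v. h > 0 \<longrightarrow> \<gamma> \<le> h"
    and "\<pi> \<in> val_ring v" and "v \<pi> = Fin \<gamma>"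
    and "expands_valued_field L v"
    and "angular_component v ac"
    and "definable L 1 (pts {x \<in> val_ring v. ac x = \<one>\<^bsub>residue_field v\<^esub>})"
    and "H_group L = UNIV"
  shows "carrier (groth_ring L) = {\<zero>\<^bsub>groth_ring L\<^esub>}
       \<and> definable_bij L (pts UNIV) (pts (UNIV - {0}))
       \<and> definable_bij L (pts (val_ring v)) (pts (val_ring v - {0}))"
proof -
  interpret valued_field v by (rule assms(1))
  have dR: "definable_subset L (val_ring v)"
    using assms(7) by (rule expands_valued_field_definable)
  interpret definable_valued_field v L \<pi> \<gamma>
    by unfold_locales (use assms(3,4,6) dR in auto)
  have iso: "def_iso L (val_ring v) (val_ring v - {0})"
    using assms(8) assms(9)[unfolded definable_pts_iff] assms(10) by (rule punctured_ring_iso)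
  \<comment> \<open>The identity outside the valuation ring extends its bijection to one from
    \<open>K\<close> to \<open>K\<^sup>\<times>\<close>.\<close>
  have "def_iso L (val_ring v \<union> (UNIV - val_ring v)) ((val_ring v - {0}) \<union> (UNIV - val_ring v))"
    by (intro def_iso_Un iso def_iso_refl definable_subset_Diff definable_subset_UNIV dR) auto
  also have "val_ring v \<union> (UNIV - val_ring v) = UNIV" by blast
  also have "(val_ring v - {0}) \<union> (UNIV - val_ring v) = UNIV - {0}"
    using val_ring_closed(1) by blast
  finally have "def_iso L UNIV (UNIV - {0})" .
  then show ?thesis
    using groth_ring_trivial[OF iso val_ring_closed(1)] iso def_iso_imp_definable_bij by blast
qed

end
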